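(* Let $X_1,X_2,\dots$ be i.i.d. Bernoulli random variables with $\Pr\{X_i=1\}=1-\Pr\{X_i=0\}=p\in(0,1)$, let $\gamma$ be a positive integer, let $\mathbf n$ be the random integer satisfying $\sum_{i=1}^{\mathbf n-1}X_i<\gamma=\sum_{i=1}^{\mathbf n}X_i$, and let $\widehat{\boldsymbol p}_\gamma=\frac{\gamma}{\mathbf n}$. Then the following hold. (I) If $\varepsilon>0$, $0<\delta<1$ and $$\gamma>\frac{1+\varepsilon}{(1+\varepsilon)\ln(1+\varepsilon)-\varepsilon}\ln\frac2\delta,$$ then $\Pr\big\{\big|\frac{\widehat{\boldsymbol p}_\gamma-p}{p}\big|<\varepsilon\big\}>1-\delta$ for every $p\in(0,1)$. (II) Suppose $0<\varepsilon<1$, $$0<\delta<\exp\left(-\frac{3\varepsilon^3(4+\varepsilon)+4\varepsilon(3+\varepsilon)\ln2}{4(9-6\varepsilon-2\varepsilon^2)}-\varepsilon\sqrt{\left[\frac{3\varepsilon^2(4+\varepsilon)+4(3+\varepsilon)\ln2}{4(9-6\varepsilon-2\varepsilon^2)}\right]^2+\frac{3(1+\varepsilon)(3+\varepsilon)\ln2}{2(9-6\varepsilon-2\varepsilon^2)}}\right),$$ and $$\gamma>\frac{1+\varepsilon}{(1+\varepsilon)\ln(1+\varepsilon)-\varepsilon}\ln\frac{1+\zeta}{\delta},$$ where $\zeta=2C_{\mathrm{BE}}\sqrt{\frac1m+\frac{z}{m-z-mz}}$ with $m=\frac2{\varepsilon^2}\ln\frac1\delta$ and $z=1+\frac{2\varepsilon}{3+\varepsilon}-\frac{9}{(3+\varepsilon)^2}\frac{\ln\frac1\delta}{\ln\frac2\delta}$.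 Then $\Pr\big\{\big|\frac{\widehat{\boldsymbol p}_\gamma-p}{p}\big|<\varepsilon\big\}>1-\delta$ for every $p\in(0,1)$.
   Context: $C_{\mathrm{BE}}$ denotes the absolute constant in the Berry–Esseen inequality: for i.i.d. $Y_1,Y_2,\dots$ distributed as $Y$ with $\mathbb{E}[Y]=0$, $\mathbb{E}[Y^2]>0$, $\mathbb{E}[|Y|^3]<\infty$, the cdf $F_n$ of $\sum_{i=1}^nY_i/\sqrt{n\mathbb{E}[Y^2]}$ satisfies $|F_n(y)-\Phi(y)|\le\frac{C_{\mathrm{BE}}}{\sqrt n}\frac{\mathbb{E}[|Y|^3]}{\mathbb{E}^{3/2}[Y^2]}$ for all $y,n$, where $\Phi$ is the standard normal cdf. *)

theory Defs
  imports "HOL-Probability.Probability"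
begin

definition Phi :: "real \<Rightarrow> real" where
  "Phi y = measure (density lborel std_normal_density) {..y}"

definition BE_valid :: "real \<Rightarrow> bool" where
  "BE_valid C \<longleftrightarrow>
    (\<forall>M :: real measure. prob_space M \<and> sets M = sets borel \<and>
       integrable M (\<lambda>y. \<bar>y\<bar> ^ 3) \<and> (\<integral>y. y \<partial>M) = 0 \<and> (\<integral>y. y\<^sup>2 \<partial>M) > 0 \<longrightarrow>
       (\<forall>n::nat. n \<ge> 1 \<longrightarrow> (\<forall>y::real.
          \<bar>measure (distr (PiM {..<n} (\<lambda>_. M)) borel
                (\<lambda>x. (\<Sum>i<n. x i) / sqrt (real n * (\<integral>y. y\<^sup>2 \<partial>M)))) {..y} - Phi y\<bar>
          \<le> C / sqrt (real n) * ((\<integral>y. \<bar>y\<bar> ^ 3 \<partial>M) / (\<integral>y. y\<^sup>2 \<partial>M) powr (3/2)))))"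

definition C_BE :: real where
  "C_BE = Inf {C. BE_valid C}"

end

theory Submission
  imports Defs
begin

text \<open>
  The event \<open>n \<le> k\<close> says that \<open>k\<close> trials produce at least \<open>\<gamma>\<close> successes, so both ways in which the
  estimate can fail are binomial tails. Chernoff's method bounds each of them by
  \<open>exp (- \<gamma> (ln (1 + \<epsilon>) - \<epsilon> / (1 + \<epsilon>)))\<close>, the exponent being the limit for small \<open>p\<close>; this gives (I).

  For (II) each tail has to be bounded by \<open>\<delta> / 2\<close>. Tilt the Bernoulli distribution so that the mean of the
  sum is exactly \<open>\<gamma>\<close>. Then the tail is at most the Chernoff bound times the probability that the
  tilted sum lies on one side of its mean, which by Berry--Esseen is \<open>1 / 2\<close> up to an error that is
  controlled as long as \<open>q = (1 \<plusminus> \<epsilon>) p\<close> stays below \<open>z < 1\<close>. For \<open>q \<ge> z\<close> the relative entropy of \<open>q\<close> and \<open>p\<close>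
  exceeds its limit for small \<open>p\<close> so much that the Chernoff bound alone is below \<open>\<delta> / 2\<close>. The condition
  on \<open>\<delta>\<close> is the quadratic inequality in \<open>ln (1 / \<delta>)\<close> that makes \<open>m - z - m z\<close> positive.

  Since \<open>C_BE\<close> is the infimum of a set of reals, nothing is known about it until some admissible
  constant is found, so the Berry--Esseen inequality itself is needed. It is proved, with the constant 84, by
  Stein's method and induction on the number of summands (Bolthausen): smooth the indicator by a
  ramp of width \<open>l\<close>, and bound the second-order error of Stein's solution through the probability that
  the shorter sum falls into an interval of length about \<open>l\<close>, for which the induction hypothesis is used.
\<close>

section \<open>The standard normal distribution\<close>

abbreviation std_normal :: "real measure" where
  "std_normal \<equiv> density lborel std_normal_density"

lemma prob_space_std_normal: "prob_space std_normal"
  by (rule prob_space_normal_density) simp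

interpretation std_normal: prob_space std_normal
  by (rule prob_space_std_normal)

lemma measure_std_normal_UNIV [simp]: "measure std_normal UNIV = 1"
  using std_normal.prob_space by simp

lemma measure_std_normal_le_length:
  assumes "a \<le> b"
  shows "measure std_normal {a<..b} \<le> b - a"
proof -
  have density_le_1: "std_normal_density x \<le> 1" for x
  proof -
    have "2 * pi > 2 * 3" using pi_gt3 by simp
    hence "sqrt (2 * pi) \<ge> 1" by simp
    hence a: "1 / sqrt (2 * pi) \<le> 1" by simp
    have b: "exp (- x\<^sup>2 / 2) \<le> 1" by simp
    show ?thesis unfolding std_normal_density_def
      using mult_mono[OF a b] by simp
  qed
  have "emeasure std_normal {a<..b} = (\<integral>\<^sup>+x. ennreal (std_normal_density x) * indicator {a<..b} x \<partial>lborel)"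
    by (subst emeasure_density) auto
  also have "\<dots> \<le> (\<integral>\<^sup>+x. indicator {a<..b} x \<partial>lborel)"
    using density_le_1 by (intro nn_integral_mono) (auto split: split_indicator)
  also have "\<dots> = ennreal (b - a)"
    using assms by simp
  finally show ?thesis
    using assms by (simp add: std_normal.emeasure_eq_measure)
qed

lemma Phi_diff_eq: "a \<le> b \<Longrightarrow> Phi b - Phi a = measure std_normal {a<..b}"
proof -
  assume "a \<le> b"
  hence "{..b} - {..a} = {a<..b}" "{..a} \<subseteq> {..b}" by auto
  thus ?thesis
    unfolding Phi_def using std_normal.finite_measure_Diff[of "{..b}" "{..a}"] by simp
qed

lemma Phi_diff_le: "a \<le> b \<Longrightarrow> Phi b - Phi a \<le> b - a"
  using Phi_diff_eq measure_std_normal_le_length by simp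

lemma Phi_nonneg: "0 \<le> Phi x" and Phi_le_1: "Phi x \<le> 1"
  by (auto simp: Phi_def)

lemma measure_std_normal_greaterThan: "measure std_normal {x<..} = 1 - Phi x"
proof -
  have "UNIV - {..x} = {x<..}" by auto
  thus ?thesis
    using std_normal.prob_compl[of "{..x}"] by (simp add: Phi_def)
qed

lemma Phi_uminus: "Phi (- x) = 1 - Phi x"
proof -
  \<comment> \<open>Reflection carries \<open>{..-x}\<close> to the closed half-line
    \<open>{x..}\<close>, while the complement of \<open>{..x}\<close> is open, so the single point
    has to be shown null.\<close>
  have atom: "emeasure std_normal {x} = 0"
  proof -
    have "emeasure std_normal {x} = (\<integral>\<^sup>+t. ennreal (std_normal_density t) * indicator {x} t \<partial>lborel)"
      by (subst emeasure_density) auto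
    also have "\<dots> = 0"
      by (subst nn_integral_0_iff_AE) (auto intro!: AE_I[of _ _ "{x}"])
    finally show ?thesis .
  qed
  have "emeasure std_normal {..-x} = (\<integral>\<^sup>+t. ennreal (std_normal_density t) * indicator {..-x} t \<partial>lborel)"
    by (subst emeasure_density) auto
  also have "\<dots> = (\<integral>\<^sup>+t. ennreal (std_normal_density (-t)) * indicator {..-x} (-t) \<partial>lborel)"
    by (subst nn_integral_real_affine[where c="-1" and t=0]) auto
  also have "\<dots> = (\<integral>\<^sup>+t. ennreal (std_normal_density t) * indicator {x..} t \<partial>lborel)"
    by (intro nn_integral_cong) (auto simp: std_normal_density_def split: split_indicator)
  also have "\<dots> = emeasure std_normal {x..}"
    by (subst emeasure_density) auto
  finally have 1: "Phi (-x) = measure std_normal {x..}"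
    by (simp add: Phi_def measure_def)
  have "{x..} = {x<..} \<union> {x}" by auto
  moreover have "measure std_normal ({x<..} \<union> {x}) = measure std_normal {x<..} + measure std_normal {x}"
    by (rule std_normal.finite_measure_Union) auto
  ultimately have "measure std_normal {x..} = measure std_normal {x<..} + measure std_normal {x}"
    by simp
  also have "measure std_normal {x} = 0"
    using atom by (simp add: measure_def)
  finally show ?thesis using 1 measure_std_normal_greaterThan by simp
qed

lemma Phi_0: "Phi 0 = 1 / 2"
  using Phi_uminus[of 0] by simp

lemma DERIV_std_normal_density:
  "(std_normal_density has_real_derivative - x * std_normal_density x) (at x)"
proof -
  have "((\<lambda>x. c * exp (- x\<^sup>2 / 2)) has_real_derivative - x * (c * exp (- x\<^sup>2 / 2))) (at x)" for c
    by (auto intro!: derivative_eq_intros)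
  thus ?thesis unfolding std_normal_density_def .
qed

text \<open>Mills' bound: on the tail the factor \<open>x\<close> may be raised to \<open>t\<close>,
  and \<open>t\<close> times the density is the derivative of minus the density, so it integrates to
  the density at \<open>x\<close>.\<close>

lemma Phi_upper_tail_le:
  assumes "0 < x"
  shows "x * (1 - Phi x) \<le> std_normal_density x"
proof -
  have d: "((\<lambda>t. - std_normal_density t) has_real_derivative t * std_normal_density t) (at t)" for t
    using DERIV_minus[OF DERIV_std_normal_density[of t]] by simp
  have lim: "((\<lambda>t. - std_normal_density t) \<longlongrightarrow> 0) at_top"
  proof -
    have "filterlim (\<lambda>t::real. t\<^sup>2 / 2) at_top at_top"
      using filterlim_tendsto_pos_mult_at_top[OF tendsto_const _ filterlim_pow_at_top[OF _ filterlim_ident],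
          of "1 / 2 :: real" 2] by simp
    hence "filterlim (\<lambda>t::real. - (t\<^sup>2 / 2)) at_bot at_top"
      by (simp add: filterlim_uminus_at_top)
    hence "((\<lambda>t::real. exp (- (t\<^sup>2 / 2))) \<longlongrightarrow> 0) at_top"
      by (rule filterlim_compose[OF exp_at_bot])
    hence "((\<lambda>t::real. - (1 / sqrt (2 * pi) * exp (- (t\<^sup>2 / 2)))) \<longlongrightarrow> - (1 / sqrt (2 * pi) * 0)) at_top"
      by (intro tendsto_intros)
    thus ?thesis by (simp add: std_normal_density_def)
  qed
  have "ennreal x * emeasure std_normal {x<..} = (\<integral>\<^sup>+t. ennreal x * (ennreal (std_normal_density t) * indicator {x<..} t) \<partial>lborel)"
    by (subst emeasure_density) (auto simp: nn_integral_cmult)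
  also have "\<dots> \<le> (\<integral>\<^sup>+t. ennreal (t * std_normal_density t) * indicator {x..} t \<partial>lborel)"
    using assms by (intro nn_integral_mono)
      (auto simp: ennreal_mult[symmetric] mult_right_mono split: split_indicator)
  also have "\<dots> = ennreal (0 - (- std_normal_density x))"
    using assms d lim by (intro nn_integral_FTC_atLeast) auto
  finally show ?thesis
    using assms Phi_le_1[of x]
    by (simp add: std_normal.emeasure_eq_measure measure_std_normal_greaterThan ennreal_mult[symmetric])
qed

text \<open>Beyond 1 this is Mills' bound. On [0,1] the density is at least its value at 1, which is
  at least 1/5 because 2 pi e < 25. The 5 becomes the bound on Stein's solution.\<close>

lemma Phi_upper_tail_le_density:
  assumes "0 \<le> x"
  shows "1 - Phi x \<le> 5 * std_normal_density x"
proof (cases "x \<le> 1")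
  case True
  have e: "exp (1::real) \<le> 3" by (rule exp_le)
  have "(sqrt (2 * pi) * exp (1/2))\<^sup>2 = 2 * pi * exp 1"
    by (simp add: power_mult_distrib exp_double[symmetric])
  also have "\<dots> \<le> (2 * 4) * 3"
    using e pi_less_4 by (intro mult_mono) auto
  finally have "(sqrt (2 * pi) * exp (1/2))\<^sup>2 \<le> 5\<^sup>2" by simp
  hence *: "sqrt (2 * pi) * exp (1/2) \<le> 5"
    by (rule power2_le_imp_le) simp
  have "x\<^sup>2 \<le> 1" using assms True by (simp add: power_le_one)
  hence "exp (- (1/2)) \<le> exp (- x\<^sup>2 / 2)" by simp
  hence "5 * (1 / sqrt (2 * pi) * exp (- (1/2))) \<le> 5 * std_normal_density x"
    unfolding std_normal_density_def by (intro mult_left_mono) auto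
  moreover have "1 \<le> 5 * (1 / sqrt (2 * pi) * exp (- (1/2)))"
    using * by (simp add: exp_minus field_simps)
  ultimately show ?thesis using Phi_nonneg[of x] by linarith
next
  case False
  have "1 * (1 - Phi x) \<le> x * (1 - Phi x)"
    using False Phi_le_1[of x] by (intro mult_right_mono) auto
  also have "\<dots> \<le> std_normal_density x"
    using False by (intro Phi_upper_tail_le) auto
  also have "\<dots> \<le> 5 * std_normal_density x" by simp
  finally show ?thesis by simp
qed

lemma std_normal_density_uminus: "std_normal_density (- x) = std_normal_density x"
  by (simp add: std_normal_density_def)

section \<open>Solving Stein's equation\<close>

text \<open>Take \<open>f = G / std_normal_density\<close>, where \<open>G\<close> integrates the
  centred function \<open>k\<close> over \<open>{..x}\<close>; the quotient rule gives the equation.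
  Since \<open>k\<close> is bounded by 1 and has mean 0, \<open>G\<close> is bounded by either
  normal tail, and the two tail estimates above bound \<open>f x\<close> and
  \<open>x * f x\<close>.\<close>

lemma stein_solution:
  fixes h :: "real \<Rightarrow> real"
  assumes cont: "continuous_on UNIV h" and h01: "\<And>x. 0 \<le> h x" "\<And>x. h x \<le> 1"
  obtains f where
    "\<And>x. (f has_real_derivative x * f x + h x - (\<integral>t. h t \<partial>std_normal)) (at x)"
    "\<And>x. \<bar>f x\<bar> \<le> 5" "\<And>x. \<bar>x * f x\<bar> \<le> 1"
proof -
  define k where "k x = h x - (\<integral>t. h t \<partial>std_normal)" for x
  have [measurable]: "h \<in> borel_measurable borel"
    using cont by (rule borel_measurable_continuous_onI)
  have contk: "continuous_on UNIV k"
    unfolding k_def by (intro continuous_intros cont)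
  have [measurable]: "k \<in> borel_measurable borel"
    using contk by (rule borel_measurable_continuous_onI)
  have int_h: "integrable std_normal h"
    using h01 by (intro std_normal.integrable_const_bound[where B=1]) auto
  have "0 \<le> (\<integral>t. h t \<partial>std_normal)"
    using h01 by simp
  moreover have "(\<integral>t. h t \<partial>std_normal) \<le> (\<integral>t. 1 \<partial>std_normal)"
    using h01 int_h by (intro integral_mono) auto
  ultimately have k1: "\<bar>k x\<bar> \<le> 1" for x
    using h01[of x] by (auto simp: k_def abs_le_iff)
  have int_k: "integrable std_normal k"
    using k1 by (intro std_normal.integrable_const_bound[where B=1]) auto
  have k0: "(\<integral>t. k t \<partial>std_normal) = 0"
    using int_h by (simp add: k_def)
  have int_ind: "integrable std_normal (\<lambda>t. indicator A t * k t)" if "A \<in> sets borel" for A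
  proof (rule std_normal.integrable_const_bound[where B=1])
    show "AE t in std_normal. norm (indicator A t * k t) \<le> 1"
      using k1 by (auto split: split_indicator)
    show "(\<lambda>t. indicator A t * k t) \<in> borel_measurable std_normal"
      using that by simp
  qed
  define G where "G x = (\<integral>t. indicator {..x} t * k t \<partial>std_normal)" for x
  have bound: "\<bar>\<integral>t. indicator A t * k t \<partial>std_normal\<bar> \<le> measure std_normal A" if "A \<in> sets borel" for A
  proof -
    have "\<bar>\<integral>t. indicator A t * k t \<partial>std_normal\<bar> \<le> (\<integral>t. \<bar>indicator A t * k t\<bar> \<partial>std_normal)"
      by (rule integral_abs_bound)
    also have "\<dots> \<le> (\<integral>t. indicator A t \<partial>std_normal)"
      using k1 int_ind[OF that] that
      by (intro integral_mono) (auto split: split_indicator simp: std_normal.emeasure_eq_measure)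
    also have "\<dots> = measure std_normal A" using that by simp
    finally show ?thesis .
  qed
  have G1: "\<bar>G x\<bar> \<le> Phi x" for x
    unfolding G_def Phi_def by (rule bound) simp
  \<comment> \<open>As \<open>k\<close> has mean 0, \<open>G x\<close> is also minus the integral
    over the upper half-line.\<close>
  have G2: "\<bar>G x\<bar> \<le> 1 - Phi x" for x
  proof -
    have "G x + (\<integral>t. indicator {x<..} t * k t \<partial>std_normal)
        = (\<integral>t. indicator {..x} t * k t + indicator {x<..} t * k t \<partial>std_normal)"
      unfolding G_def by (subst Bochner_Integration.integral_add) (auto intro!: int_ind)
    also have "\<dots> = (\<integral>t. k t \<partial>std_normal)"
      by (intro Bochner_Integration.integral_cong) (auto split: split_indicator)
    finally have "G x = - (\<integral>t. indicator {x<..} t * k t \<partial>std_normal)" using k0 by simp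
    thus ?thesis
      using bound[of "{x<..}"] by (simp add: measure_std_normal_greaterThan)
  qed
  \<comment> \<open>Increments of \<open>G\<close> become integrals over compact intervals, so that
    the fundamental theorem of calculus applies; here the continuity of \<open>h\<close>
    enters.\<close>
  have Gdiff: "G u = G a + integral {a..u} (\<lambda>t. std_normal_density t * k t)" if "a \<le> u" for a u
  proof -
    have cont': "continuous_on {a..u} (\<lambda>t. std_normal_density t * k t)"
      unfolding std_normal_density_def
      by (intro continuous_intros continuous_on_subset[OF contk]) auto
    have "G u = (\<integral>t. indicator {..a} t * k t + indicator {a<..u} t * k t \<partial>std_normal)"
      unfolding G_def using that
      by (intro Bochner_Integration.integral_cong) (auto split: split_indicator)
    also have "\<dots> = G a + (\<integral>t. indicator {a<..u} t * k t \<partial>std_normal)"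
      unfolding G_def by (intro Bochner_Integration.integral_add int_ind) auto
    also have "(\<integral>t. indicator {a<..u} t * k t \<partial>std_normal)
        = (\<integral>t. std_normal_density t * (indicator {a<..u} t * k t) \<partial>lborel)"
      by (subst integral_density) auto
    also have "\<dots> = (LINT t:{a..u}|lborel. std_normal_density t * k t)"
      unfolding set_lebesgue_integral_def
      using AE_lborel_singleton[of a]
      by (intro integral_cong_AE) (auto split: split_indicator)
    also have "\<dots> = integral {a..u} (\<lambda>t. std_normal_density t * k t)"
      using cont' by (intro set_borel_integral_eq_integral borel_integrable_atLeastAtMost')
    finally show ?thesis .
  qed
  have Gderiv: "(G has_real_derivative std_normal_density x * k x) (at x)" for x
  proof -
    have cont': "continuous_on {x-1..x+1} (\<lambda>t. std_normal_density t * k t)"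
      unfolding std_normal_density_def
      by (intro continuous_intros continuous_on_subset[OF contk]) auto
    have "((\<lambda>u. integral {x-1..u} (\<lambda>t. std_normal_density t * k t)) has_real_derivative
        std_normal_density x * k x) (at x within {x-1..x+1})"
      by (rule integral_has_real_derivative[OF cont']) auto
    hence "((\<lambda>u. G (x-1) + integral {x-1..u} (\<lambda>t. std_normal_density t * k t)) has_real_derivative
        std_normal_density x * k x) (at x within {x-1..x+1})"
      by (auto intro!: derivative_eq_intros)
    hence "(G has_real_derivative std_normal_density x * k x) (at x within {x-1..x+1})"
      by (rule has_field_derivative_transform_within[where d=1]) (auto simp: Gdiff)
    thus ?thesis
      using at_within_interior[of x "{x-1..x+1}"] by simp
  qed
  define f where "f x = G x / std_normal_density x" for x
  have pos: "std_normal_density x > 0" for x by (rule normal_density_pos) simp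
  have 1: "(f has_real_derivative x * f x + h x - (\<integral>t. h t \<partial>std_normal)) (at x)" for x
  proof -
    have "(f has_real_derivative
        (std_normal_density x * k x * std_normal_density x - G x * (- x * std_normal_density x))
          / (std_normal_density x * std_normal_density x)) (at x)"
      unfolding f_def using less_imp_neq[OF pos[of x]]
      by (intro DERIV_divide Gderiv DERIV_std_normal_density) auto
    moreover have "(std_normal_density x * k x * std_normal_density x - G x * (- x * std_normal_density x))
          / (std_normal_density x * std_normal_density x) = x * f x + k x"
      using pos[of x] by (simp add: f_def field_simps)
    ultimately show ?thesis by (simp only: k_def add_diff_eq)
  qed
  have Gmin: "\<bar>G x\<bar> \<le> 1 - Phi \<bar>x\<bar>" for x
    using G1[of x] G2[of x] Phi_uminus[of x] by (cases "x \<ge> 0") auto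
  have dens_abs: "std_normal_density \<bar>x\<bar> = std_normal_density x" for x
    using std_normal_density_uminus by (auto simp: abs_if)
  have 2: "\<bar>f x\<bar> \<le> 5" for x
    using Gmin[of x] Phi_upper_tail_le_density[of "\<bar>x\<bar>"] pos[of x]
    by (simp add: f_def dens_abs field_simps)
  have 3: "\<bar>x * f x\<bar> \<le> 1" for x
  proof (cases "x = 0")
    case False
    have "\<bar>x\<bar> * \<bar>G x\<bar> \<le> \<bar>x\<bar> * (1 - Phi \<bar>x\<bar>)"
      by (intro mult_left_mono Gmin) auto
    also have "\<dots> \<le> std_normal_density x"
      using Phi_upper_tail_le[of "\<bar>x\<bar>"] False by (simp add: dens_abs)
    finally show ?thesis using pos[of x] by (simp add: f_def abs_mult field_simps)
  qed auto
  show thesis using that[of f] 1 2 3 by blast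
qed

section \<open>Convolution powers\<close>

text \<open>The law of a sum of \<open>n\<close> independent copies, built one summand at a time so
  that inductions can split off the last summand without random variables.\<close>

primrec conv_power :: "real measure \<Rightarrow> nat \<Rightarrow> real measure" where
  "conv_power M 0 = return borel 0"
| "conv_power M (Suc n) = convolution (conv_power M n) M"

lemma sets_conv_power [simp, measurable_cong]: "sets (conv_power M n) = sets borel"
  by (cases n) auto

lemma space_conv_power [simp]: "space (conv_power M n) = UNIV"
  using sets_eq_imp_space_eq[OF sets_conv_power] by simp

lemma integrable_pair_fst:
  fixes g :: "'a \<Rightarrow> real"
  assumes "prob_space M" "integrable N g"
  shows "integrable (N \<Otimes>\<^sub>M M) (\<lambda>z. g (fst z))"
proof -
  have "integrable (distr (N \<Otimes>\<^sub>M M) N fst) g"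
    using assms by (simp only: prob_space.distr_pair_fst)
  thus ?thesis
    using borel_measurable_integrable[OF assms(2)] by (subst (asm) integrable_distr_eq) auto
qed

lemma integrable_pair_snd:
  fixes g :: "'a \<Rightarrow> real"
  assumes "prob_space N" "prob_space M" "integrable M g"
  shows "integrable (N \<Otimes>\<^sub>M M) (\<lambda>z. g (snd z))"
proof -
  interpret N: prob_space N by fact
  interpret M: prob_space M by fact
  interpret pair_sigma_finite N M ..
  show ?thesis
    using integrable_product_swap_iff[of "\<lambda>z. g (snd z)"] integrable_pair_fst[OF assms(1,3)]
    by (simp add: case_prod_unfold)
qed

lemma integrable_return:
  fixes f :: "'a \<Rightarrow> real"
  assumes "f \<in> borel_measurable N" "x \<in> space N"
  shows "integrable (return N x) f"
proof (rule integrableI_bounded)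
  show "f \<in> borel_measurable (return N x)" using assms by simp
  have "(\<integral>\<^sup>+y. ennreal (norm (f y)) \<partial>return N x) = ennreal (norm (f x))"
    using assms by (intro nn_integral_return) auto
  thus "(\<integral>\<^sup>+y. ennreal (norm (f y)) \<partial>return N x) < \<infinity>" by simp
qed

lemma integrable_mult_bounded:
  fixes f k :: "'a \<Rightarrow> real"
  assumes "integrable N f" "k \<in> borel_measurable N" "\<And>s. \<bar>k s\<bar> \<le> B"
  shows "integrable N (\<lambda>s. f s * k s)"
proof (rule Bochner_Integration.integrable_bound)
  show "integrable N (\<lambda>s. B * f s)" using assms(1) by simp
  show "AE s in N. norm (f s * k s) \<le> norm (B * f s)"
  proof (rule AE_I2)
    fix s
    have "\<bar>k s\<bar> * \<bar>f s\<bar> \<le> \<bar>B\<bar> * \<bar>f s\<bar>"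
      using assms(3)[of s] by (intro mult_right_mono) auto
    thus "norm (f s * k s) \<le> norm (B * f s)" by (simp add: abs_mult mult.commute)
  qed
qed (use assms in auto)

locale real_prob_measure = prob_space M for M :: "real measure" +
  assumes sets_M [simp, measurable_cong]: "sets M = sets borel"
begin

lemma space_M [simp]: "space M = UNIV"
  using sets_eq_imp_space_eq[OF sets_M] by simp

lemma prob_space_conv_power: "prob_space (conv_power M n)"
proof (induction n)
  case (Suc n)
  then interpret N: prob_space "conv_power M n" .
  interpret P: pair_prob_space "conv_power M n" M ..
  show ?case
    by (simp add: convolution_def P.prob_space_distr)
qed (simp add: prob_space_return)

lemma pair_prob_space_conv_power: "pair_prob_space (conv_power M n) M"
proof -
  interpret N: prob_space "conv_power M n" by (rule prob_space_conv_power)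
  show ?thesis ..
qed

lemma integrable_conv_power_Suc_iff:
  fixes g :: "real \<Rightarrow> real"
  assumes [measurable]: "g \<in> borel_measurable borel"
  shows "integrable (conv_power M (Suc n)) g \<longleftrightarrow>
    integrable (conv_power M n \<Otimes>\<^sub>M M) (\<lambda>z. g (fst z + snd z))"
  by (simp add: convolution_def integrable_distr_eq case_prod_unfold)

lemma integral_conv_power_Suc:
  fixes g :: "real \<Rightarrow> real"
  assumes [measurable]: "g \<in> borel_measurable borel"
    and int: "integrable (conv_power M (Suc n)) g"
  shows "(\<integral>s. g s \<partial>conv_power M (Suc n)) = (\<integral>y. (\<integral>x. g (x + y) \<partial>conv_power M n) \<partial>M)"
    and "integrable M (\<lambda>y. \<integral>x. g (x + y) \<partial>conv_power M n)"
proof -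
  interpret P: pair_prob_space "conv_power M n" M by (rule pair_prob_space_conv_power)
  have 1: "integrable (conv_power M n \<Otimes>\<^sub>M M) (\<lambda>(x, y). g (x + y))"
    using int by (simp only: integrable_conv_power_Suc_iff[OF assms(1)] case_prod_unfold)
  have "(\<integral>s. g s \<partial>conv_power M (Suc n)) = (\<integral>z. (\<lambda>(x, y). g (x + y)) z \<partial>(conv_power M n \<Otimes>\<^sub>M M))"
    by (simp add: convolution_def integral_distr case_prod_beta)
  also have "\<dots> = (\<integral>y. (\<integral>x. g (x + y) \<partial>conv_power M n) \<partial>M)"
    using P.integral_snd[OF 1] by simp
  finally show "(\<integral>s. g s \<partial>conv_power M (Suc n)) = (\<integral>y. (\<integral>x. g (x + y) \<partial>conv_power M n) \<partial>M)" .
  show "integrable M (\<lambda>y. \<integral>x. g (x + y) \<partial>conv_power M n)"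
    using P.integrable_snd[OF 1] .
qed

lemma integrable_conv_power_bounded:
  fixes g :: "real \<Rightarrow> real"
  assumes "g \<in> borel_measurable borel" "\<And>x. \<bar>g x\<bar> \<le> B"
  shows "integrable (conv_power M n) g"
proof -
  interpret N: prob_space "conv_power M n" by (rule prob_space_conv_power)
  show ?thesis using assms by (intro N.integrable_const_bound[where B=B]) auto
qed

lemma abs_integral_conv_power_le:
  fixes g :: "real \<Rightarrow> real"
  assumes "g \<in> borel_measurable borel" "\<And>x. \<bar>g x\<bar> \<le> B"
  shows "\<bar>\<integral>x. g x \<partial>conv_power M n\<bar> \<le> B"
proof -
  interpret N: prob_space "conv_power M n" by (rule prob_space_conv_power)
  have "\<bar>\<integral>x. g x \<partial>conv_power M n\<bar> \<le> (\<integral>x. \<bar>g x\<bar> \<partial>conv_power M n)"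
    by (rule integral_abs_bound)
  also have "\<dots> \<le> (\<integral>x. B \<partial>conv_power M n)"
    using integrable_conv_power_bounded[OF assms] assms by (intro integral_mono) auto
  finally show ?thesis using N.prob_space by simp
qed

lemma measurable_integral_conv_power [measurable]:
  fixes g :: "real \<Rightarrow> real"
  assumes [measurable]: "g \<in> borel_measurable borel"
  shows "(\<lambda>y. \<integral>x. g (x + y) \<partial>conv_power M n) \<in> borel_measurable borel"
proof -
  interpret N: prob_space "conv_power M n" by (rule prob_space_conv_power)
  show ?thesis by measurable
qed

end

section \<open>Laws with mean 0 and variance 1: moments and exchangeability\<close>

locale standardized_measure = real_prob_measure +
  assumes integrable_abs_cube: "integrable M (\<lambda>y. \<bar>y\<bar> ^ 3)"
    and mean_0: "(\<integral>y. y \<partial>M) = 0"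
    and second_moment_1: "(\<integral>y. y\<^sup>2 \<partial>M) = 1"
begin

definition abs_moment3 :: real where
  "abs_moment3 = (\<integral>y. \<bar>y\<bar> ^ 3 \<partial>M)"

lemma integrable_square: "integrable M (\<lambda>y. y\<^sup>2)"
proof (rule Bochner_Integration.integrable_bound)
  show "integrable M (\<lambda>y. 1 + \<bar>y\<bar> ^ 3)"
    using integrable_abs_cube by simp
  show "AE y in M. norm (y\<^sup>2) \<le> norm (1 + \<bar>y\<bar> ^ 3)"
  proof (rule AE_I2)
    fix y :: real
    have "\<bar>y\<bar>\<^sup>2 \<le> 1 + \<bar>y\<bar> ^ 3"
    proof (cases "\<bar>y\<bar> \<le> 1")
      case True
      hence "\<bar>y\<bar>\<^sup>2 \<le> 1" by (intro power_le_one) auto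
      thus ?thesis by (simp add: add_increasing2)
    next
      case False
      hence "\<bar>y\<bar> ^ 2 \<le> \<bar>y\<bar> ^ 3" by (intro power_increasing) auto
      thus ?thesis by linarith
    qed
    thus "norm (y\<^sup>2) \<le> norm (1 + \<bar>y\<bar> ^ 3)" by simp
  qed
qed auto

lemma abs_le_square: "\<bar>y::real\<bar> \<le> (1 + y\<^sup>2) / 2"
  using zero_le_power2[of "\<bar>y\<bar> - 1"] by (simp add: power2_diff)

lemma integrable_ident: "integrable M (\<lambda>y. y)"
proof (rule Bochner_Integration.integrable_bound)
  show "integrable M (\<lambda>y. (1 + y\<^sup>2) / 2)"
    using integrable_square by simp
  show "AE y in M. norm y \<le> norm ((1 + y\<^sup>2) / 2)"
    using abs_le_square by auto
qed auto

lemma abs_moment1_le: "(\<integral>y. \<bar>y\<bar> \<partial>M) \<le> 1"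
proof -
  have "(\<integral>y. \<bar>y\<bar> \<partial>M) \<le> (\<integral>y. (1 + y\<^sup>2) / 2 \<partial>M)"
    using integrable_square integrable_ident abs_le_square by (intro integral_mono) auto
  thus ?thesis using integrable_square second_moment_1 prob_space by simp
qed

text \<open>Integrate a pointwise inequality with equality at |y| = 1. The result makes the
  Berry--Esseen bound trivial for one summand and absorbs first absolute moments into third
  ones.\<close>

lemma abs_moment3_ge: "1 \<le> abs_moment3"
proof -
  have "y\<^sup>2 \<le> 1/3 + 2/3 * \<bar>y\<bar> ^ 3" for y :: real
  proof -
    have "0 \<le> (\<bar>y\<bar> - 1)\<^sup>2 * (2 * \<bar>y\<bar> + 1)" by simp
    also have "\<dots> = 2 * \<bar>y\<bar> ^ 3 - 3 * \<bar>y\<bar>\<^sup>2 + 1" by (simp add: algebra_simps power2_eq_square power3_eq_cube)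
    finally show ?thesis by simp
  qed
  hence "(\<integral>y. y\<^sup>2 \<partial>M) \<le> (\<integral>y. 1/3 + 2/3 * \<bar>y\<bar> ^ 3 \<partial>M)"
    using integrable_square integrable_abs_cube by (intro integral_mono) auto
  thus ?thesis using integrable_abs_cube second_moment_1 prob_space by (simp add: abs_moment3_def)
qed

lemma conv_power_moments:
  "integrable (conv_power M n) (\<lambda>s. s)" (is ?A)
  "integrable (conv_power M n) (\<lambda>s. s\<^sup>2)" (is ?B)
  "(\<integral>s. s \<partial>conv_power M n) = 0" (is ?C)
  "(\<integral>s. s\<^sup>2 \<partial>conv_power M n) = real n" (is ?D)
proof -
  have "?A \<and> ?B \<and> ?C \<and> ?D"
  proof (induction n)
    case 0
    show ?case
      by (auto intro!: integrable_return simp: integral_return)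
  next
    case (Suc n)
    interpret N: prob_space "conv_power M n" by (rule prob_space_conv_power)
    interpret P: pair_prob_space "conv_power M n" M by (rule pair_prob_space_conv_power)
    have IH: "integrable (conv_power M n) (\<lambda>s. s)" "integrable (conv_power M n) (\<lambda>s. s\<^sup>2)"
      "(\<integral>s. s \<partial>conv_power M n) = 0" "(\<integral>s. s\<^sup>2 \<partial>conv_power M n) = real n"
      using Suc.IH by auto
    have i1: "integrable (conv_power M (Suc n)) (\<lambda>s. s)"
      using integrable_pair_fst[OF prob_space_axioms IH(1)] integrable_pair_snd[OF N.prob_space_axioms prob_space_axioms integrable_ident]
      by (subst integrable_conv_power_Suc_iff) auto
    have i2: "integrable (conv_power M (Suc n)) (\<lambda>s. s\<^sup>2)"
    proof (subst integrable_conv_power_Suc_iff)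
      show "integrable (conv_power M n \<Otimes>\<^sub>M M) (\<lambda>z. (fst z + snd z)\<^sup>2)"
      proof (rule Bochner_Integration.integrable_bound)
        show "integrable (conv_power M n \<Otimes>\<^sub>M M) (\<lambda>z. 2 * (fst z)\<^sup>2 + 2 * (snd z)\<^sup>2)"
          using integrable_pair_fst[OF prob_space_axioms IH(2)] integrable_pair_snd[OF N.prob_space_axioms prob_space_axioms integrable_square] by simp
        have "(x + y)\<^sup>2 \<le> 2 * x\<^sup>2 + 2 * y\<^sup>2" for x y :: real
          using zero_le_power2[of "x - y"] by (simp add: power2_diff power2_sum)
        thus "AE z in conv_power M n \<Otimes>\<^sub>M M. norm ((fst z + snd z)\<^sup>2)
            \<le> norm (2 * (fst z)\<^sup>2 + 2 * (snd z)\<^sup>2)"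
          by (intro AE_I2) (simp add: case_prod_unfold)
      qed measurable
    qed auto
    have "(\<integral>s. s \<partial>conv_power M (Suc n)) = (\<integral>y. (\<integral>x. x + y \<partial>conv_power M n) \<partial>M)"
      using integral_conv_power_Suc(1)[OF _ i1] by simp
    also have "\<dots> = (\<integral>y. y \<partial>M)"
      using IH N.prob_space by simp
    finally have e1: "(\<integral>s. s \<partial>conv_power M (Suc n)) = 0" using mean_0 by simp
    have "(\<integral>s. s\<^sup>2 \<partial>conv_power M (Suc n)) = (\<integral>y. (\<integral>x. (x + y)\<^sup>2 \<partial>conv_power M n) \<partial>M)"
      using integral_conv_power_Suc(1)[OF _ i2] by simp
    also have "\<dots> = (\<integral>y. real n + y\<^sup>2 \<partial>M)"
      using IH N.prob_space by (simp add: power2_sum)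
    also have "\<dots> = real n + 1"
      using integrable_square second_moment_1 prob_space by simp
    finally show ?case using i1 i2 e1 by simp
  qed
  thus ?A ?B ?C ?D by auto
qed

text \<open>By exchangeability of the summands, each of them contributes equally to the left-hand side.\<close>

lemma conv_power_exchange:
  fixes g :: "real \<Rightarrow> real"
  assumes [measurable]: "g \<in> borel_measurable borel" and g: "\<And>x. \<bar>g x\<bar> \<le> B"
  shows "(\<integral>s. s * g s \<partial>conv_power M (Suc n))
    = real (Suc n) * (\<integral>y. y * (\<integral>x. g (x + y) \<partial>conv_power M n) \<partial>M)"
  using assms
proof (induction n arbitrary: g)
  case (0 g)
  note [measurable] = 0(1)
  have sg: "integrable (conv_power M (Suc 0)) (\<lambda>s. s * g s)"
    by (rule integrable_mult_bounded[OF conv_power_moments(1) _ 0(2)]) simp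
  have "(\<integral>s. s * g s \<partial>conv_power M (Suc 0)) = (\<integral>y. (\<integral>x. (x + y) * g (x + y) \<partial>return borel 0) \<partial>M)"
    using integral_conv_power_Suc(1)[OF _ sg] by simp
  also have "\<dots> = (\<integral>y. y * g y \<partial>M)"
    by (subst integral_return) auto
  also have "\<dots> = (\<integral>y. y * (\<integral>x. g (x + y) \<partial>return borel 0) \<partial>M)"
    by (subst integral_return) auto
  finally show ?case by simp
next
  case (Suc n g)
  note [measurable] = Suc.prems(1)
  note g = Suc.prems(2)
  interpret MM: pair_prob_space M M ..
  define H where "H u = (\<integral>x. g (x + u) \<partial>conv_power M n)" for u
  define K where "K u = (\<integral>x. g (x + u) \<partial>conv_power M (Suc n))" for u
  have [measurable]: "H \<in> borel_measurable borel" "K \<in> borel_measurable borel"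
    unfolding H_def K_def by measurable
  have H: "\<bar>H u\<bar> \<le> B" and K: "\<bar>K u\<bar> \<le> B" for u
    unfolding H_def K_def by (rule abs_integral_conv_power_le[OF _ g], simp)+
  have sg: "integrable (conv_power M k) (\<lambda>s. s * g (s + y))" for k y
    by (rule integrable_mult_bounded[OF conv_power_moments(1) _ g]) simp
  have int_g: "integrable (conv_power M k) (\<lambda>s. g (s + y))" for k y
    by (rule integrable_conv_power_bounded[OF _ g]) simp
  have K_H: "K u = (\<integral>y. H (u + y) \<partial>M)" for u
    unfolding K_def H_def
    using integral_conv_power_Suc(1)[OF _ int_g[of "Suc n" u]] by (simp add: add_ac)
  \<comment> \<open>The induction hypothesis, applied to a translate of \<open>g\<close>, singles
    out one of the first \<open>n + 1\<close> summands; \<open>H\<close> averages over the remaining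
    \<open>n\<close>.\<close>
  have inner: "(\<integral>x. x * g (x + y) \<partial>conv_power M (Suc n)) = real (Suc n) * (\<integral>x. x * H (x + y) \<partial>M)" for y
    using Suc.IH[of "\<lambda>x. g (x + y)"] g by (simp add: H_def add_ac)
  have int_xH: "integrable (M \<Otimes>\<^sub>M M) (\<lambda>(x, y). x * H (x + y))"
  proof -
    have "integrable (M \<Otimes>\<^sub>M M) (\<lambda>z. fst z * H (fst z + snd z))"
    proof (rule integrable_mult_bounded[where B=B])
      show "integrable (M \<Otimes>\<^sub>M M) (\<lambda>z. fst z)"
        by (intro integrable_pair_fst integrable_ident prob_space_axioms)
    qed (use H in auto)
    thus ?thesis by (simp add: case_prod_unfold)
  qed
  \<comment> \<open>Exchanging the singled-out summand with the last one: averaging \<open>H\<close>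
    over the latter yields \<open>K\<close>.\<close>
  have fub: "(\<integral>y. (\<integral>x. x * H (x + y) \<partial>M) \<partial>M) = (\<integral>x. x * K x \<partial>M)"
    using MM.Fubini_integral[OF int_xH] by (simp add: K_H)
  have int1: "integrable M (\<lambda>y. \<integral>x. x * H (x + y) \<partial>M)"
    using MM.integrable_snd[OF int_xH] .
  have int2: "integrable M (\<lambda>y. y * K y)"
    by (rule integrable_mult_bounded[OF integrable_ident _ K]) simp
  have "(\<integral>s. s * g s \<partial>conv_power M (Suc (Suc n)))
      = (\<integral>y. (\<integral>x. (x + y) * g (x + y) \<partial>conv_power M (Suc n)) \<partial>M)"
    using sg[of "Suc (Suc n)" 0] by (intro integral_conv_power_Suc(1)) auto
  also have "\<dots> = (\<integral>y. real (Suc n) * (\<integral>x. x * H (x + y) \<partial>M) + y * K y \<partial>M)"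
    using sg[of "Suc n"] int_g[of "Suc n"]
    by (simp only: distrib_right Bochner_Integration.integral_add integrable_mult_right
        integral_mult_right_zero inner K_def)
  also have "\<dots> = real (Suc n) * (\<integral>y. (\<integral>x. x * H (x + y) \<partial>M) \<partial>M) + (\<integral>y. y * K y \<partial>M)"
    using int1 int2 by simp
  also have "\<dots> = real (Suc (Suc n)) * (\<integral>y. y * K y \<partial>M)"
    unfolding fub by (simp add: algebra_simps)
  finally show ?case by (simp add: K_def)
qed

end

section \<open>The Berry--Esseen inequality\<close>

text \<open>A continuous function lying between the indicators of \<open>{..z}\<close> and
  \<open>{..z + l}\<close>, with slope \<open>- 1 / l\<close> in between.\<close>

definition ramp :: "real \<Rightarrow> real \<Rightarrow> real \<Rightarrow> real" where
  "ramp z l x = max 0 (min 1 ((z + l - x) / l))"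

lemma ramp_nonneg: "0 \<le> ramp z l x" and ramp_le_1: "ramp z l x \<le> 1"
  by (auto simp: ramp_def)

lemma continuous_on_ramp: "l > 0 \<Longrightarrow> continuous_on S (ramp z l)"
  unfolding ramp_def by (intro continuous_intros) auto

lemma borel_measurable_ramp [measurable]: "ramp z l \<in> borel_measurable borel"
  unfolding ramp_def by measurable

lemma ramp_eq_1: "l > 0 \<Longrightarrow> x \<le> z \<Longrightarrow> ramp z l x = 1"
  by (simp add: ramp_def min_def max_def field_simps)

lemma ramp_eq_0: "l > 0 \<Longrightarrow> z + l \<le> x \<Longrightarrow> ramp z l x = 0"
  by (simp add: ramp_def min_def max_def field_simps)

text \<open>The slope and the range give the two terms of the minimum. Outside the interval both
  arguments lie on the same flat piece, so the increment vanishes.\<close>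

lemma ramp_increment_le:
  assumes "l > 0"
  shows "\<bar>ramp z l (x + s) - ramp z l x\<bar> \<le> min 1 (\<bar>s\<bar> / l) * indicator {z - \<bar>s\<bar><..z + l + \<bar>s\<bar>} x"
proof (cases "x \<in> {z - \<bar>s\<bar><..z + l + \<bar>s\<bar>}")
  case True
  have "\<bar>(z + l - (x + s)) / l - (z + l - x) / l\<bar> = \<bar>s\<bar> / l"
    using assms by (simp add: diff_divide_distrib[symmetric] abs_divide)
  moreover have "\<bar>max 0 (min 1 u) - max 0 (min 1 v)\<bar> \<le> \<bar>u - v\<bar>" for u v :: real
    by (simp add: max_def min_def)
  ultimately have "\<bar>ramp z l (x + s) - ramp z l x\<bar> \<le> \<bar>s\<bar> / l"
    unfolding ramp_def by metis
  moreover have "\<bar>ramp z l (x + s) - ramp z l x\<bar> \<le> 1"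
    using ramp_nonneg[of z l x] ramp_nonneg[of z l "x + s"] ramp_le_1[of z l x] ramp_le_1[of z l "x + s"]
    by linarith
  ultimately show ?thesis using True by simp
next
  case False
  hence "x \<le> z - \<bar>s\<bar> \<or> x > z + l + \<bar>s\<bar>" by auto
  thus ?thesis
  proof
    assume "x \<le> z - \<bar>s\<bar>"
    hence "x \<le> z" "x + s \<le> z" by linarith+
    thus ?thesis using assms False by (simp add: ramp_eq_1)
  next
    assume "x > z + l + \<bar>s\<bar>"
    hence "z + l \<le> x" "z + l \<le> x + s" by linarith+
    thus ?thesis using assms False by (simp add: ramp_eq_0)
  qed
qed

text \<open>A bound for the increments over a distance at most \<open>a\<close> of the derivative of Stein's
  solution for \<open>ramp z l\<close>.\<close>

definition stein_modulus :: "real \<Rightarrow> real \<Rightarrow> real \<Rightarrow> real \<Rightarrow> real" where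
  "stein_modulus z l x a = a * (5 + 2 * \<bar>x\<bar>) + min 1 (a / l) * indicator {z - a<..z + l + a} x"

lemma stein_modulus_mono:
  assumes "l > 0" "0 \<le> a" "a \<le> b"
  shows "stein_modulus z l x a \<le> stein_modulus z l x b"
  unfolding stein_modulus_def
proof (intro add_mono mult_mono)
  show "min 1 (a / l) \<le> min 1 (b / l)"
    using assms by (intro min.mono divide_right_mono) auto
  show "indicator {z - a<..z + l + a} x \<le> (indicator {z - b<..z + l + b} x :: real)"
    using assms by (auto split: split_indicator)
qed (use assms in auto)

text \<open>From |x f| \<le> 1 the equation gives |f'| \<le> 2, so \<open>f\<close> is 2-Lipschitz.
  An increment of f' splits into \<open>s * f (x + s)\<close>, \<open>x * (f (x + s) - f x)\<close>
  and an increment of the ramp; these are the terms 5, 2|x| and the indicator in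
  \<open>stein_modulus\<close>.\<close>

lemma stein_ramp:
  assumes l: "l > 0"
  obtains f f' :: "real \<Rightarrow> real" where
    "f \<in> borel_measurable borel" "f' \<in> borel_measurable borel"
    "\<And>x. f' x - x * f x = ramp z l x - (\<integral>t. ramp z l t \<partial>std_normal)"
    "\<And>x. \<bar>f x\<bar> \<le> 5" "\<And>x. \<bar>f' x\<bar> \<le> 2"
    "\<And>x s. \<bar>f' (x + s) - f' x\<bar> \<le> stein_modulus z l x \<bar>s\<bar>"
    "\<And>x s. \<bar>f (x + s) - f x - s * f' x\<bar> \<le> \<bar>s\<bar> * stein_modulus z l x \<bar>s\<bar>"
proof -
  define c where "c = (\<integral>t. ramp z l t \<partial>std_normal)"
  have int: "integrable std_normal (ramp z l)"
    using ramp_nonneg ramp_le_1 by (intro std_normal.integrable_const_bound[where B=1]) auto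
  have c: "0 \<le> c" "c \<le> 1"
  proof -
    show "0 \<le> c" unfolding c_def using ramp_nonneg by simp
    have "c \<le> (\<integral>t. 1 \<partial>std_normal)"
      unfolding c_def using int ramp_le_1 by (intro integral_mono) auto
    thus "c \<le> 1" by simp
  qed
  obtain f where f: "\<And>x. (f has_real_derivative x * f x + ramp z l x - c) (at x)"
    and f5: "\<And>x. \<bar>f x\<bar> \<le> 5" and xf: "\<And>x. \<bar>x * f x\<bar> \<le> 1"
    using stein_solution[of "ramp z l"] continuous_on_ramp[OF l] ramp_nonneg ramp_le_1
    unfolding c_def by metis
  define f' where "f' x = x * f x + ramp z l x - c" for x
  have df: "(f has_real_derivative f' x) (at x)" for x
    using f by (simp add: f'_def)
  have "continuous_on UNIV f"
    using f by (auto intro!: continuous_at_imp_continuous_on DERIV_isCont)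
  hence [measurable]: "f \<in> borel_measurable borel"
    by (rule borel_measurable_continuous_onI)
  have [measurable]: "f' \<in> borel_measurable borel"
    unfolding f'_def by measurable
  have f'2: "\<bar>f' x\<bar> \<le> 2" for x
    using xf[of x] ramp_nonneg[of z l x] ramp_le_1[of z l x] c unfolding f'_def by linarith
  have mvt: "\<exists>t. 0 \<le> t \<and> t \<le> 1 \<and> f (x + s) - f x = s * f' (x + t * s)" for x s
  proof -
    have "((\<lambda>t. f (x + t * s)) has_real_derivative s * f' (x + t * s)) (at t)" for t
    proof -
      have "((\<lambda>t. x + t * s) has_real_derivative s) (at t)"
        by (auto intro!: derivative_eq_intros)
      from DERIV_chain2[OF df this] show ?thesis by (simp add: mult.commute)
    qed
    hence "\<exists>t>0. t < 1 \<and> f (x + 1 * s) - f (x + 0 * s) = (1 - 0) * (s * f' (x + t * s))"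
      by (intro MVT2) auto
    thus ?thesis by (auto intro: less_imp_le)
  qed
  have f_lip: "\<bar>f (x + s) - f x\<bar> \<le> 2 * \<bar>s\<bar>" for x s
  proof -
    obtain t where "f (x + s) - f x = s * f' (x + t * s)" using mvt by blast
    thus ?thesis using mult_left_mono[OF f'2[of "x + t * s"], of "\<bar>s\<bar>"] by (simp add: abs_mult mult.commute)
  qed
  have incr: "\<bar>f' (x + s) - f' x\<bar> \<le> stein_modulus z l x \<bar>s\<bar>" for x s
  proof -
    have "f' (x + s) - f' x = s * f (x + s) + x * (f (x + s) - f x) + (ramp z l (x + s) - ramp z l x)"
      by (simp add: f'_def algebra_simps)
    moreover have "\<bar>s * f (x + s)\<bar> \<le> \<bar>s\<bar> * 5"
      unfolding abs_mult using f5 by (intro mult_left_mono) auto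
    moreover have "\<bar>x * (f (x + s) - f x)\<bar> \<le> \<bar>x\<bar> * (2 * \<bar>s\<bar>)"
      unfolding abs_mult using f_lip by (intro mult_left_mono) auto
    moreover have "\<bar>s\<bar> * 5 + \<bar>x\<bar> * (2 * \<bar>s\<bar>) = \<bar>s\<bar> * (5 + 2 * \<bar>x\<bar>)"
      by (simp add: algebra_simps)
    ultimately show ?thesis
      using ramp_increment_le[OF l, of z x s] unfolding stein_modulus_def by linarith
  qed
  have taylor: "\<bar>f (x + s) - f x - s * f' x\<bar> \<le> \<bar>s\<bar> * stein_modulus z l x \<bar>s\<bar>" for x s
  proof -
    obtain t where t: "0 \<le> t" "t \<le> 1" "f (x + s) - f x = s * f' (x + t * s)" using mvt by blast
    \<comment> \<open>The intermediate point of the mean value theorem is no farther than |s| from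
      x, so monotonicity of the modulus covers it.\<close>
    have "\<bar>t * s\<bar> \<le> \<bar>s\<bar>" using t mult_right_mono[of t 1 "\<bar>s\<bar>"] by (simp add: abs_mult)
    hence "\<bar>f' (x + t * s) - f' x\<bar> \<le> stein_modulus z l x \<bar>s\<bar>"
      using order_trans[OF incr[of x "t * s"] stein_modulus_mono[OF l]] by auto
    moreover have "f (x + s) - f x - s * f' x = s * (f' (x + t * s) - f' x)"
      using t(3) by (simp add: algebra_simps)
    ultimately show ?thesis by (simp add: abs_mult mult_left_mono)
  qed
  show thesis
    using that[of f f'] f5 f'2 incr taylor by (auto simp: f'_def c_def)
qed

lemma integral_ramp_le: "l > 0 \<Longrightarrow> (\<integral>t. ramp z l t \<partial>std_normal) \<le> Phi (z + l)"
  and integral_ramp_ge: "l > 0 \<Longrightarrow> Phi z \<le> (\<integral>t. ramp z l t \<partial>std_normal)"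
proof -
  assume l: "l > 0"
  have int: "integrable std_normal (ramp z l)"
    using ramp_nonneg ramp_le_1 by (intro std_normal.integrable_const_bound[where B=1]) auto
  have Phi: "Phi y = (\<integral>t. indicator {..y} t \<partial>std_normal)" for y
    by (simp add: Phi_def)
  have int_ind: "integrable std_normal (indicator {..y} :: real \<Rightarrow> real)" for y
    by (simp add: std_normal.emeasure_eq_measure)
  show "(\<integral>t. ramp z l t \<partial>std_normal) \<le> Phi (z + l)"
    unfolding Phi using int int_ind ramp_le_1 ramp_eq_0[OF l, of z]
    by (intro integral_mono) (auto split: split_indicator simp: not_le)
  show "Phi z \<le> (\<integral>t. ramp z l t \<partial>std_normal)"
    unfolding Phi using int int_ind ramp_nonneg ramp_eq_1[OF l, of _ z]
    by (intro integral_mono) (auto split: split_indicator)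
qed

section \<open>The induction step, leaving out one summand\<close>

context standardized_measure
begin

text \<open>The linear part contributes \<open>7 * a\<close>, as the scaled sum has first absolute
  moment at most 1. The interval has probability at most \<open>2 * (l + 2 * a) + 2 * d\<close> by
  comparison with the normal law; times \<open>min 1 (a / l)\<close> this is at most
  \<open>6 * a + 2 * a * d / l\<close>.\<close>

lemma integral_stein_modulus_le:
  assumes n: "n \<ge> 1" and l: "l > 0" and a: "a \<ge> 0"
    and IH: "\<And>y. \<bar>measure (conv_power M n) {..y} - Phi (y / sqrt n)\<bar> \<le> d"
  shows "integrable (conv_power M n) (\<lambda>x. stein_modulus z l (x / sqrt (Suc n)) a)" (is ?I)
    and "(\<integral>x. stein_modulus z l (x / sqrt (Suc n)) a \<partial>conv_power M n) \<le> a * (13 + 2 * d / l)" (is ?L)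
proof -
  interpret N: prob_space "conv_power M n" by (rule prob_space_conv_power)
  define r where "r = sqrt (Suc n)"
  have r: "r > 0" "r\<^sup>2 = Suc n" by (auto simp: r_def)
  have d: "d \<ge> 0" using IH[of 0] by linarith
  have int_abs: "integrable (conv_power M n) (\<lambda>x. \<bar>x / r\<bar>)"
    using conv_power_moments(1) by simp
  have moment: "(\<integral>x. \<bar>x / r\<bar> \<partial>conv_power M n) \<le> 1"
  proof -
    have "(\<integral>x. \<bar>x / r\<bar> \<partial>conv_power M n) \<le> (\<integral>x. (1 + x\<^sup>2 / r\<^sup>2) / 2 \<partial>conv_power M n)"
    proof (rule integral_mono[OF int_abs])
      show "integrable (conv_power M n) (\<lambda>x. (1 + x\<^sup>2 / r\<^sup>2) / 2)"
        using conv_power_moments(2) by simp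
      show "\<bar>x / r\<bar> \<le> (1 + x\<^sup>2 / r\<^sup>2) / 2" for x
        using abs_le_square[of "x / r"] by (simp only: power_divide)
    qed
    also have "\<dots> = (1 + n / r\<^sup>2) / 2"
      using conv_power_moments[of n] N.prob_space by simp
    also have "\<dots> \<le> 1" by (simp add: r field_simps)
    finally show ?thesis .
  qed
  define A where "A = {z - a<..z + l + a}"
  have set: "(\<lambda>x. indicator A (x / r)) = (indicator {r * (z - a)<..r * (z + l + a)} :: real \<Rightarrow> real)"
    using r(1) by (auto simp: A_def fun_eq_iff field_simps split: split_indicator)
  have int_ind: "integrable (conv_power M n) (\<lambda>x. indicator A (x / r) :: real)"
    unfolding set by (simp add: N.emeasure_eq_measure)
  have conc: "(\<integral>x. indicator A (x / r) \<partial>conv_power M n) \<le> 2 * (l + 2 * a) + 2 * d"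
  proof -
    define u v where "u = r * (z - a)" and "v = r * (z + l + a)"
    have uv: "u \<le> v" using r l a by (auto simp: u_def v_def)
    hence "{..v} - {..u} = {u<..v}" "{..u} \<subseteq> {..v}" by auto
    hence "measure (conv_power M n) {u<..v} = measure (conv_power M n) {..v} - measure (conv_power M n) {..u}"
      using N.finite_measure_Diff[of "{..v}" "{..u}"] by simp
    also have "\<dots> \<le> Phi (v / sqrt n) - Phi (u / sqrt n) + 2 * d"
      using IH[of u] IH[of v] by linarith
    also have "\<dots> \<le> v / sqrt n - u / sqrt n + 2 * d"
      using Phi_diff_le[of "u / sqrt n" "v / sqrt n"] uv by (simp add: divide_right_mono)
    also have "v / sqrt n - u / sqrt n = (v - u) / sqrt n"
      by (simp only: diff_divide_distrib)
    also have "v - u = r * (l + 2 * a)"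
      by (simp add: u_def v_def algebra_simps)
    also have "r * (l + 2 * a) / sqrt n = r / sqrt n * (l + 2 * a)"
      by simp
    also have "\<dots> \<le> 2 * (l + 2 * a)"
    proof (intro mult_right_mono)
      \<comment> \<open>The sum of \<open>n\<close> terms is scaled by sqrt(n + 1) here but by
        sqrt(n) in the hypothesis; the crude bound n + 1 \<le> 4n keeps the factor an
        integer.\<close>
      have "r \<le> sqrt (4 * n)" unfolding r_def using n by (intro real_sqrt_le_mono) linarith
      also have "\<dots> = 2 * sqrt n" by (simp add: real_sqrt_mult)
      finally show "r / sqrt n \<le> 2" using n by (simp add: field_simps)
    qed (use l a in auto)
    finally show ?thesis unfolding set by (simp add: u_def v_def)
  qed
  define t where "t = min 1 (a / l)"
  have t: "0 \<le> t" "t \<le> 1" "t \<le> a / l" using a l by (auto simp: t_def)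
  have eq: "stein_modulus z l (x / sqrt (Suc n)) a = a * (5 + 2 * \<bar>x / r\<bar>) + t * indicator A (x / r)" for x
    by (simp add: stein_modulus_def t_def A_def r_def)
  show ?I
    unfolding eq using int_abs int_ind by (intro Bochner_Integration.integrable_add integrable_mult_right) auto
  have "(\<integral>x. stein_modulus z l (x / sqrt (Suc n)) a \<partial>conv_power M n)
      = a * (5 + 2 * (\<integral>x. \<bar>x / r\<bar> \<partial>conv_power M n)) + t * (\<integral>x. indicator A (x / r) \<partial>conv_power M n)"
    unfolding eq using int_abs int_ind N.prob_space
    by (subst Bochner_Integration.integral_add) (auto simp del: abs_divide)
  also have "\<dots> \<le> a * (5 + 2 * 1) + t * (2 * (l + 2 * a) + 2 * d)"
    using moment conc a t by (intro add_mono mult_left_mono) auto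
  also have "t * (2 * (l + 2 * a) + 2 * d) = 2 * (t * l) + 4 * (t * a) + t * (2 * d)"
    by (simp add: algebra_simps)
  also have "\<dots> \<le> 2 * a + 4 * a + a / l * (2 * d)"
  proof (intro add_mono mult_left_mono mult_right_mono)
    show "t * l \<le> a" using t(3) l by (simp add: field_simps)
    show "t * a \<le> a" using t a by (simp add: mult_left_le_one_le)
  qed (use t d in auto)
  also have "a * (5 + 2 * 1) + (2 * a + 4 * a + a / l * (2 * d)) = a * (13 + 2 * d / l)"
    by (simp add: algebra_simps)
  finally show ?L by simp
qed

text \<open>By Stein's equation the error is E f'(W) - E W f(W) for the scaled sum W of
  \<open>n + 1\<close> terms. Expanding around the sum of \<open>n\<close> terms, both expectations
  contain the same main term \<open>a0\<close>. The remainders \<open>A\<close> and \<open>R\<close>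
  are at most \<open>k * |y|\<close> and \<open>k * y^2 / r\<close>, and each contributes at most
  \<open>k * abs_moment3\<close>.\<close>

lemma smoothed_berry_esseen_step:
  assumes n: "n \<ge> 1" and l: "l > 0"
    and IH: "\<And>y. \<bar>measure (conv_power M n) {..y} - Phi (y / sqrt n)\<bar> \<le> d"
  shows "\<bar>(\<integral>s. ramp z l (s / sqrt (Suc n)) \<partial>conv_power M (Suc n)) - (\<integral>t. ramp z l t \<partial>std_normal)\<bar>
    \<le> 2 * abs_moment3 * ((13 + 2 * d / l) / sqrt (Suc n))"
proof -
  interpret N: prob_space "conv_power M n" by (rule prob_space_conv_power)
  interpret N': prob_space "conv_power M (Suc n)" by (rule prob_space_conv_power)
  define r where "r = sqrt (Suc n)"
  have r: "r > 0" "r * r = Suc n" by (auto simp: r_def)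
  define k where "k = (13 + 2 * d / l) / r"
  have d: "d \<ge> 0" using IH[of 0] by linarith
  have k: "k \<ge> 0" using d l r by (simp add: k_def)
  obtain f f' :: "real \<Rightarrow> real" where
    meas [measurable]: "f \<in> borel_measurable borel" "f' \<in> borel_measurable borel"
    and stein: "\<And>x. f' x - x * f x = ramp z l x - (\<integral>t. ramp z l t \<partial>std_normal)"
    and f5: "\<And>x. \<bar>f x\<bar> \<le> 5" and f'2: "\<And>x. \<bar>f' x\<bar> \<le> 2"
    and incr: "\<And>x s. \<bar>f' (x + s) - f' x\<bar> \<le> stein_modulus z l x \<bar>s\<bar>"
    and taylor: "\<And>x s. \<bar>f (x + s) - f x - s * f' x\<bar> \<le> \<bar>s\<bar> * stein_modulus z l x \<bar>s\<bar>"
    using stein_ramp[OF l, of z] by metis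
  have int_f: "integrable (conv_power M m) (\<lambda>x. f ((x + y) / r))" for m y
    by (rule integrable_conv_power_bounded[OF _ f5]) simp
  have int_f': "integrable (conv_power M m) (\<lambda>x. f' ((x + y) / r))" for m y
    by (rule integrable_conv_power_bounded[OF _ f'2]) simp
  define a0 where "a0 = (\<integral>x. f' (x / r) \<partial>conv_power M n)"
  define c0 where "c0 = (\<integral>x. f (x / r) \<partial>conv_power M n)"
  define A where "A y = (\<integral>x. f' ((x + y) / r) \<partial>conv_power M n) - a0" for y
  define R where "R y = (\<integral>x. f ((x + y) / r) \<partial>conv_power M n) - c0 - y / r * a0" for y
  have [measurable]: "A \<in> borel_measurable borel" "R \<in> borel_measurable borel"
    unfolding A_def R_def by measurable
  have modulus_int: "(\<integral>x. stein_modulus z l (x / r) \<bar>y / r\<bar> \<partial>conv_power M n) \<le> k * \<bar>y\<bar>"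
    and modulus_integrable: "integrable (conv_power M n) (\<lambda>x. stein_modulus z l (x / r) \<bar>y / r\<bar>)" for y
    using integral_stein_modulus_le[OF n l _ IH, of "\<bar>y / r\<bar>" z] r unfolding r_def[symmetric]
    by (auto simp: k_def mult.commute)
  have A: "\<bar>A y\<bar> \<le> k * \<bar>y\<bar>" for y
  proof -
    have eq: "A y = (\<integral>x. f' ((x + y) / r) - f' (x / r) \<partial>conv_power M n)"
      unfolding A_def a0_def using int_f'[of n y] int_f'[of n 0] by simp
    have "\<bar>A y\<bar> \<le> (\<integral>x. \<bar>f' ((x + y) / r) - f' (x / r)\<bar> \<partial>conv_power M n)"
      unfolding eq by (rule integral_abs_bound)
    also have "\<dots> \<le> (\<integral>x. stein_modulus z l (x / r) \<bar>y / r\<bar> \<partial>conv_power M n)"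
      using int_f'[of n y] int_f'[of n 0] modulus_integrable incr[of _ "y / r"]
      by (intro integral_mono) (auto simp: add_divide_distrib)
    finally show ?thesis using modulus_int[of y] by linarith
  qed
  have R: "\<bar>R y\<bar> \<le> \<bar>y / r\<bar> * (k * \<bar>y\<bar>)" for y
  proof -
    have eq: "R y = (\<integral>x. f ((x + y) / r) - f (x / r) - y / r * f' (x / r) \<partial>conv_power M n)"
      unfolding R_def c0_def a0_def using int_f[of n y] int_f[of n 0] int_f'[of n 0] by simp
    have "\<bar>R y\<bar> \<le> (\<integral>x. \<bar>f ((x + y) / r) - f (x / r) - y / r * f' (x / r)\<bar> \<partial>conv_power M n)"
      unfolding eq by (rule integral_abs_bound)
    also have "\<dots> \<le> (\<integral>x. \<bar>y / r\<bar> * stein_modulus z l (x / r) \<bar>y / r\<bar> \<partial>conv_power M n)"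
    proof (rule integral_mono)
      show "integrable (conv_power M n) (\<lambda>x. \<bar>f ((x + y) / r) - f (x / r) - y / r * f' (x / r)\<bar>)"
        using int_f[of n y] int_f[of n 0] int_f'[of n 0]
        by (intro integrable_abs Bochner_Integration.integrable_diff integrable_mult_right) auto
      show "integrable (conv_power M n) (\<lambda>x. \<bar>y / r\<bar> * stein_modulus z l (x / r) \<bar>y / r\<bar>)"
        using modulus_integrable by (intro integrable_mult_right) auto
      show "\<bar>f ((x + y) / r) - f (x / r) - y / r * f' (x / r)\<bar> \<le> \<bar>y / r\<bar> * stein_modulus z l (x / r) \<bar>y / r\<bar>" for x
        using taylor[of "x / r" "y / r"] by (simp only: add_divide_distrib)
    qed
    also have "\<dots> \<le> \<bar>y / r\<bar> * (k * \<bar>y\<bar>)"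
      using modulus_int[of y] by (subst integral_mult_right_zero) (intro mult_left_mono, auto)
    finally show ?thesis .
  qed
  have int_A: "integrable M A"
  proof (rule Bochner_Integration.integrable_bound)
    show "integrable M (\<lambda>y. k * y)" using integrable_ident by simp
  qed (use A k in \<open>auto simp: abs_mult\<close>)
  have yR: "\<bar>y * R y\<bar> \<le> k / r * \<bar>y\<bar> ^ 3" for y
    using mult_left_mono[OF R[of y], of "\<bar>y\<bar>"] r
    by (simp add: abs_mult power3_eq_cube mult_ac)
  have int_yR: "integrable M (\<lambda>y. y * R y)"
  proof (rule Bochner_Integration.integrable_bound)
    show "integrable M (\<lambda>y. k / r * \<bar>y\<bar> ^ 3)" using integrable_abs_cube by simp
    show "AE y in M. norm (y * R y) \<le> norm (k / r * \<bar>y\<bar> ^ 3)"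
      unfolding real_norm_def by (rule AE_I2) (rule order_trans[OF yR abs_ge_self])
  qed auto
  have E1: "(\<integral>s. f' (s / r) \<partial>conv_power M (Suc n)) = (\<integral>y. A y \<partial>M) + a0"
  proof -
    have "(\<integral>s. f' (s / r) \<partial>conv_power M (Suc n)) = (\<integral>y. A y + a0 \<partial>M)"
      using integral_conv_power_Suc(1)[of "\<lambda>s. f' (s / r)" n] int_f'[of "Suc n" 0] by (simp add: A_def)
    thus ?thesis using int_A prob_space by simp
  qed
  \<comment> \<open>Exchangeability singles out one summand Y, around which f is
    \<open>c0 + y / r * a0 + R y\<close>. The \<open>c0\<close> term vanishes by mean 0; the next
    one gives \<open>a0\<close> by variance 1 and r^2 = n + 1.\<close>
  have E2: "(\<integral>s. s / r * f (s / r) \<partial>conv_power M (Suc n)) = r * (\<integral>y. y * R y \<partial>M) + a0"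
  proof -
    have "(\<integral>s. s / r * f (s / r) \<partial>conv_power M (Suc n)) = (\<integral>s. s * f (s / r) \<partial>conv_power M (Suc n)) / r"
      by simp
    also have "\<dots> = real (Suc n) * (\<integral>y. y * (\<integral>x. f ((x + y) / r) \<partial>conv_power M n) \<partial>M) / r"
      using conv_power_exchange[of "\<lambda>s. f (s / r)" 5 n] f5 by simp
    also have "(\<lambda>y. y * (\<integral>x. f ((x + y) / r) \<partial>conv_power M n)) = (\<lambda>y. y * R y + c0 * y + a0 / r * y\<^sup>2)"
      by (simp add: R_def fun_eq_iff algebra_simps power2_eq_square)
    also have "(\<integral>y. y * R y + c0 * y + a0 / r * y\<^sup>2 \<partial>M) = (\<integral>y. y * R y \<partial>M) + a0 / r"
      using int_yR integrable_ident integrable_square mean_0 second_moment_1 by simp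
    also have "real (Suc n) * ((\<integral>y. y * R y \<partial>M) + a0 / r) / r = r * (\<integral>y. y * R y \<partial>M) + a0"
      unfolding r(2)[symmetric] using r(1) by (simp add: field_simps)
    finally show ?thesis .
  qed
  have int_W: "integrable (conv_power M (Suc n)) (\<lambda>s. s / r * f (s / r))"
  proof (rule integrable_mult_bounded)
    show "integrable (conv_power M (Suc n)) (\<lambda>s. s / r)"
      using conv_power_moments(1)[of "Suc n"] by (rule integrable_divide)
    show "\<bar>f (s / r)\<bar> \<le> 5" for s by (rule f5)
  qed simp
  have int_ramp: "integrable (conv_power M (Suc n)) (\<lambda>s. ramp z l (s / r))"
    by (rule integrable_conv_power_bounded[where B=1]) (use ramp_nonneg ramp_le_1 in auto)
  have "(\<integral>s. ramp z l (s / r) \<partial>conv_power M (Suc n)) - (\<integral>t. ramp z l t \<partial>std_normal)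
      = (\<integral>s. ramp z l (s / r) - (\<integral>t. ramp z l t \<partial>std_normal) \<partial>conv_power M (Suc n))"
    using int_ramp N'.prob_space by (simp del: conv_power.simps)
  also have "\<dots> = (\<integral>s. f' (s / r) - s / r * f (s / r) \<partial>conv_power M (Suc n))"
    by (simp only: stein)
  also have "\<dots> = (\<integral>y. A y \<partial>M) - r * (\<integral>y. y * R y \<partial>M)"
    using int_f'[of "Suc n" 0] int_W E1 E2 by simp
  finally have eq: "(\<integral>s. ramp z l (s / r) \<partial>conv_power M (Suc n)) - (\<integral>t. ramp z l t \<partial>std_normal)
      = (\<integral>y. A y \<partial>M) - r * (\<integral>y. y * R y \<partial>M)" .
  have "\<bar>\<integral>y. A y \<partial>M\<bar> \<le> (\<integral>y. k * \<bar>y\<bar> \<partial>M)"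
    using A int_A integrable_ident
    by (intro order_trans[OF integral_abs_bound] integral_mono) auto
  also have "\<dots> \<le> k * abs_moment3"
    using abs_moment1_le abs_moment3_ge k
    by (simp add: mult_left_mono)
  finally have b1: "\<bar>\<integral>y. A y \<partial>M\<bar> \<le> k * abs_moment3" .
  have "\<bar>\<integral>y. y * R y \<partial>M\<bar> \<le> (\<integral>y. k / r * \<bar>y\<bar> ^ 3 \<partial>M)"
  proof (rule order_trans[OF integral_abs_bound], rule integral_mono)
    show "integrable M (\<lambda>y. \<bar>y * R y\<bar>)" using int_yR by (rule integrable_abs)
    show "integrable M (\<lambda>y. k / r * \<bar>y\<bar> ^ 3)" using integrable_abs_cube by simp
  qed (rule yR)
  also have "\<dots> = k / r * abs_moment3"
    by (simp add: abs_moment3_def)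
  finally have "r * \<bar>\<integral>y. y * R y \<partial>M\<bar> \<le> r * (k / r * abs_moment3)"
    using r by (intro mult_left_mono) auto
  hence b2: "\<bar>r * (\<integral>y. y * R y \<partial>M)\<bar> \<le> k * abs_moment3"
    using r by (simp add: abs_mult)
  have "2 * abs_moment3 * k = k * abs_moment3 + k * abs_moment3" by simp
  thus ?thesis
    unfolding r_def[symmetric] eq k_def[symmetric] using b1 b2 by linarith
qed

text \<open>Replacing the indicator by a ramp costs at most \<open>l\<close>, since
  \<open>Phi\<close> is 1-Lipschitz, and the smoothed error is at most \<open>e\<close> by the
  induction hypothesis. It remains to choose \<open>l\<close> so that \<open>l + e\<close>
  reproduces the constant.\<close>

theorem berry_esseen_conv_power:
  assumes "n \<ge> 1"
  shows "\<bar>measure (conv_power M n) {..y} - Phi (y / sqrt n)\<bar> \<le> 84 * abs_moment3 / sqrt n"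
  using assms
proof (induction n arbitrary: y rule: nat_induct_at_least)
  case base
  interpret N: prob_space "conv_power M 1" by (rule prob_space_conv_power)
  have "\<bar>measure (conv_power M 1) {..y} - Phi (y / sqrt 1)\<bar> \<le> 1"
    using N.prob_le_1[of "{..y}"] measure_nonneg[of "conv_power M 1" "{..y}"]
      Phi_nonneg[of "y / sqrt 1"] Phi_le_1[of "y / sqrt 1"] by linarith
  also have "\<dots> \<le> 84 * abs_moment3 / sqrt 1" using abs_moment3_ge by simp
  finally show ?case by simp
next
  case (Suc n)
  interpret N': prob_space "conv_power M (Suc n)" by (rule prob_space_conv_power)
  define b where "b = abs_moment3"
  have b: "b \<ge> 1" using abs_moment3_ge by (simp add: b_def)
  define r where "r = sqrt (Suc n)"
  have r: "r > 0" by (simp add: r_def)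
  \<comment> \<open>With width 16 b/r the hypothesis 84 b/sqrt(n) makes e = 26 b/r + 21 b/sqrt(n).
    As 1/sqrt(n) \<le> 2/r, the total is at most (16 + 26 + 42) b/r = 84 b/r.\<close>
  define l where "l = 16 * b / r"
  have l: "l > 0" using b r by (simp add: l_def)
  define e where "e = 2 * abs_moment3 * ((13 + 2 * (84 * abs_moment3 / sqrt n) / l) / r)"
  have step: "\<bar>(\<integral>s. ramp z l (s / r) \<partial>conv_power M (Suc n)) - (\<integral>t. ramp z l t \<partial>std_normal)\<bar> \<le> e" for z
    unfolding e_def r_def using Suc by (intro smoothed_berry_esseen_step l) auto
  have int_ramp: "integrable (conv_power M (Suc n)) (\<lambda>s. ramp z l (s / r))" for z
    by (rule integrable_conv_power_bounded[where B=1]) (use ramp_nonneg ramp_le_1 in auto)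
  have int_ind: "integrable (conv_power M (Suc n)) (indicator {..y} :: real \<Rightarrow> real)"
    by (rule integrable_conv_power_bounded[where B=1]) (auto split: split_indicator)
  define z where "z = y / r"
  have z: "s \<le> y \<longleftrightarrow> s / r \<le> z" for s using r by (simp add: z_def divide_le_cancel)
  have "measure (conv_power M (Suc n)) {..y} = (\<integral>s. indicator {..y} s \<partial>conv_power M (Suc n))"
    by simp
  also have "\<dots> \<le> (\<integral>s. ramp z l (s / r) \<partial>conv_power M (Suc n))"
    using int_ind int_ramp ramp_nonneg ramp_eq_1[OF l, of _ z]
    by (intro integral_mono) (auto split: split_indicator simp: z)
  also have "\<dots> \<le> Phi (z + l) + e"
    using step[of z] integral_ramp_le[OF l, of z] by linarith
  finally have up: "measure (conv_power M (Suc n)) {..y} \<le> Phi z + l + e"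
    using Phi_diff_le[of z "z + l"] l by linarith
  \<comment> \<open>The ramp moved left by its width lies below the indicator, which gives the lower
    estimate.\<close>
  have "(\<integral>s. ramp (z - l) l (s / r) \<partial>conv_power M (Suc n)) \<le> (\<integral>s. indicator {..y} s \<partial>conv_power M (Suc n))"
    using int_ind int_ramp ramp_le_1 ramp_eq_0[OF l, of "z - l"]
    by (intro integral_mono) (auto split: split_indicator simp: z not_le)
  hence lo: "Phi z - l - e \<le> measure (conv_power M (Suc n)) {..y}"
    using step[of "z - l"] integral_ramp_ge[OF l, of "z - l"] Phi_diff_le[of "z - l" z] l by simp
  have "r \<le> sqrt (4 * n)" unfolding r_def using Suc by (intro real_sqrt_le_mono) linarith
  also have "\<dots> = 2 * sqrt n" by (simp add: real_sqrt_mult)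
  finally have rn: "1 / sqrt n \<le> 2 / r" using Suc r by (simp add: field_simps)
  have "l + e = 42 * (b / r) + 21 * b * (1 / sqrt n)"
    using b r Suc by (simp add: e_def l_def b_def[symmetric] field_simps)
  also have "\<dots> \<le> 42 * (b / r) + 21 * b * (2 / r)"
    using rn b by (intro add_left_mono mult_left_mono) auto
  finally have "l + e \<le> 84 * b / r" by simp
  thus ?case
    using up lo unfolding z_def r_def b_def by linarith
qed

end

section \<open>From convolution powers to independent variables and product measures\<close>

lemma (in prob_space) distr_iid_sum:
  fixes X :: "nat \<Rightarrow> 'a \<Rightarrow> real"
  assumes "indep_vars (\<lambda>_. borel) X {..<n}" "\<And>i. i < n \<Longrightarrow> distr M borel (X i) = Q"
  shows "distr M borel (\<lambda>\<omega>. \<Sum>i<n. X i \<omega>) = conv_power Q n"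
  using assms
proof (induction n)
  case (Suc n)
  have rv [measurable]: "X i \<in> borel_measurable M" if "i < Suc n" for i
    using Suc.prems(1) that by (auto simp: indep_vars_def)
  have "indep_vars (\<lambda>_. borel) X {..<n}"
    using Suc.prems(1) by (rule indep_vars_subset) auto
  hence IH: "distr M borel (\<lambda>\<omega>. \<Sum>i<n. X i \<omega>) = conv_power Q n"
    using Suc by simp
  have sum_rv: "(\<lambda>\<omega>. \<Sum>i<n. X i \<omega>) \<in> borel_measurable M"
    using rv by (intro borel_measurable_sum) auto
  have "indep_var borel (X n) borel (\<lambda>\<omega>. \<Sum>i\<in>{..<n}. X i \<omega>)"
    using Suc.prems(1) by (intro indep_vars_sum) (auto simp: lessThan_Suc)
  hence "distr M borel (\<lambda>\<omega>. X n \<omega> + (\<Sum>i<n. X i \<omega>)) = convolution (distr M borel (X n)) (conv_power Q n)"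
    using sum_indep_random_variable[of "X n" "\<lambda>\<omega>. \<Sum>i<n. X i \<omega>"] sum_rv rv IH by simp
  also have "\<dots> = convolution (conv_power Q n) (distr M borel (X n))"
    unfolding IH[symmetric] using sum_rv rv
    by (intro convolution_commutative finite_measure_distr) auto
  finally show ?case using Suc.prems(2)[of n] by (simp add: add.commute)
qed simp

lemma (in real_prob_measure) distr_PiM_sum:
  fixes f :: "real \<Rightarrow> real"
  assumes [measurable]: "f \<in> borel_measurable borel"
  shows "distr (PiM {..<n} (\<lambda>_. M)) borel (\<lambda>x. \<Sum>i<n. f (x i)) = conv_power (distr M borel f) n"
proof -
  interpret P: product_prob_space "\<lambda>_::nat. M" "{..<n}" ..
  have component: "distr (PiM {..<n} (\<lambda>_. M)) M (\<lambda>x. x i) = M" if "i < n" for i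
    using that by (intro distr_PiM_component) (auto simp: prob_space_axioms)
  show ?thesis
  \<comment> \<open>The characterisation of independence by the product law is applied to a nonempty
    index set; for \<open>n = 0\<close> both sides are the point mass at 0.\<close>
  proof (cases "n = 0")
    case True
    thus ?thesis using P.distr_const[of 0 borel] by simp
  next
    case False
    have "distr (PiM {..<n} (\<lambda>_. M)) (PiM {..<n} (\<lambda>_. M)) (\<lambda>x. \<lambda>i\<in>{..<n}. x i)
        = distr (PiM {..<n} (\<lambda>_. M)) (PiM {..<n} (\<lambda>_. M)) (\<lambda>x. x)"
      by (intro distr_cong) (auto simp: space_PiM)
    also have "\<dots> = (\<Pi>\<^sub>M i\<in>{..<n}. distr (PiM {..<n} (\<lambda>_. M)) M (\<lambda>x. x i))"
      using component by (subst distr_id) (intro PiM_cong, auto)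
    finally have "P.indep_vars (\<lambda>_. M) (\<lambda>i x. x i) {..<n}"
      using False by (subst P.indep_vars_iff_distr_eq_PiM') auto
    hence "P.indep_vars (\<lambda>_. borel) (\<lambda>i x. f (x i)) {..<n}"
      by (rule P.indep_vars_compose2) auto
    thus ?thesis
    proof (rule P.distr_iid_sum)
    fix i assume i: "i < n"
    have "distr (PiM {..<n} (\<lambda>_. M)) borel (\<lambda>x. f (x i))
        = distr (distr (PiM {..<n} (\<lambda>_. M)) M (\<lambda>x. x i)) borel f"
      using i by (subst distr_distr) (auto simp: comp_def)
    thus "distr (PiM {..<n} (\<lambda>_. M)) borel (\<lambda>x. f (x i)) = distr M borel f"
      using component[OF i] by simp
    qed
  qed
qed

lemma measure_distr_PiM_scaled_sum:
  fixes n :: nat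
  assumes "prob_space M" "sets M = sets (borel :: real measure)" "n \<ge> 1" "c > 0"
  shows "measure (distr (PiM {..<n} (\<lambda>_. M)) borel (\<lambda>x. (\<Sum>i<n. x i) / c)) {..y}
    = measure (conv_power M n) {..c * y}"
proof -
  interpret real_prob_measure M
    using assms by (simp add: real_prob_measure_def real_prob_measure_axioms_def)
  have [measurable]: "(\<lambda>x. \<Sum>i<n. x i) \<in> borel_measurable (PiM {..<n} (\<lambda>_. M))"
    by measurable
  have "distr M borel (\<lambda>x. x) = M"
    using distr_id2[of borel M] by simp
  hence "conv_power M n = distr (PiM {..<n} (\<lambda>_. M)) borel (\<lambda>x. \<Sum>i<n. x i)"
    using distr_PiM_sum[of "\<lambda>x. x" n] by simp
  moreover have "(\<lambda>x. (\<Sum>i<n. x i) / c) -` {..y} = (\<lambda>x. \<Sum>i<n. x i) -` {..c * y}"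
    using assms(4) by (auto simp: field_simps)
  ultimately show ?thesis
    by (simp add: measure_distr)
qed

text \<open>Dividing by the standard deviation reduces to variance 1 and divides the third moment by
  \<open>v powr (3/2)\<close>. This is the witness that the set defining \<open>C_BE\<close> is
  nonempty.\<close>

lemma BE_valid_84: "BE_valid 84"
  unfolding BE_valid_def
proof (intro allI impI, elim conjE)
  fix M :: "real measure" and n :: nat and y :: real
  assume M: "prob_space M" "sets M = sets borel" and cube: "integrable M (\<lambda>y. \<bar>y\<bar> ^ 3)"
    and mean: "(\<integral>y. y \<partial>M) = 0" and var: "0 < (\<integral>y. y\<^sup>2 \<partial>M)" and n: "1 \<le> n"
  interpret real_prob_measure M
    using M by (simp add: real_prob_measure_def real_prob_measure_axioms_def)
  define v where "v = (\<integral>y. y\<^sup>2 \<partial>M)"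
  define \<sigma> where "\<sigma> = sqrt v"
  have v: "v > 0" and \<sigma>: "\<sigma> > 0" "\<sigma>\<^sup>2 = v" using var by (auto simp: v_def \<sigma>_def)
  define Q where "Q = distr M borel (\<lambda>y. y / \<sigma>)"
  interpret Q: standardized_measure Q
  proof (intro standardized_measure.intro real_prob_measure.intro real_prob_measure_axioms.intro
      standardized_measure_axioms.intro)
    show "prob_space Q"
      unfolding Q_def by (rule prob_space_distr) simp
    show "sets Q = sets borel" by (simp add: Q_def)
    show "integrable Q (\<lambda>y. \<bar>y\<bar> ^ 3)"
      unfolding Q_def using cube by (subst integrable_distr_eq) (auto simp: power_divide)
    show "(\<integral>y. y \<partial>Q) = 0"
      unfolding Q_def using mean by (subst integral_distr) auto
    show "(\<integral>y. y\<^sup>2 \<partial>Q) = 1"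
      unfolding Q_def using \<sigma> v by (subst integral_distr) (auto simp: power_divide v_def)
  qed
  have moment3: "Q.abs_moment3 = (\<integral>y. \<bar>y\<bar> ^ 3 \<partial>M) / v powr (3/2)"
  proof -
    have "Q.abs_moment3 = (\<integral>y. \<bar>y\<bar> ^ 3 / \<sigma> ^ 3 \<partial>M)"
      unfolding Q.abs_moment3_def unfolding Q_def using \<sigma> by (subst integral_distr) (auto simp: power_divide)
    also have "\<sigma> ^ 3 = v powr (3/2)"
      using v by (simp add: \<sigma>_def powr_half_sqrt[symmetric] powr_powr flip: powr_realpow)
    finally show ?thesis by simp
  qed
  have sums: "measure (distr (PiM {..<n} (\<lambda>_. M)) borel (\<lambda>x. (\<Sum>i<n. x i) / sqrt (real n * v))) {..y}
      = measure (conv_power Q n) {..sqrt n * y}"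
  proof -
    have [measurable]: "(\<lambda>x. \<Sum>i<n. x i / \<sigma>) \<in> borel_measurable (PiM {..<n} (\<lambda>_. M))"
      by measurable
    have "(\<lambda>x. (\<Sum>i<n. x i) / sqrt (real n * v)) -` {..y} = (\<lambda>x. \<Sum>i<n. x i / \<sigma>) -` {..sqrt n * y}"
      using n \<sigma> by (auto simp: real_sqrt_mult \<sigma>_def sum_divide_distrib[symmetric] field_simps)
    thus ?thesis
      unfolding Q_def using distr_PiM_sum[of "\<lambda>y. y / \<sigma>" n, symmetric]
      by (simp add: measure_distr)
  qed
  have "\<bar>measure (conv_power Q n) {..sqrt n * y} - Phi (sqrt n * y / sqrt n)\<bar> \<le> 84 * Q.abs_moment3 / sqrt n"
    by (rule Q.berry_esseen_conv_power[OF n])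
  thus "\<bar>measure (distr (PiM {..<n} (\<lambda>_. M)) borel (\<lambda>x. (\<Sum>i<n. x i) / sqrt (real n * (\<integral>y. y\<^sup>2 \<partial>M)))) {..y} - Phi y\<bar>
      \<le> 84 / sqrt n * ((\<integral>y. \<bar>y\<bar> ^ 3 \<partial>M) / (\<integral>y. y\<^sup>2 \<partial>M) powr (3/2))"
    using n sums moment3 unfolding v_def[symmetric] by (simp add: mult.commute)
qed

section \<open>Bernoulli sums\<close>

text \<open>The two parameters cover the 0-1 law (1 and 0) as well as the centred law and its
  reflection (\<open>c\<close> and \<open>- c * \<theta>\<close> with c = 1 or c = -1).\<close>

definition bernoulli_affine :: "real \<Rightarrow> real \<Rightarrow> real \<Rightarrow> real measure" where
  "bernoulli_affine p a b = distr (measure_pmf (bernoulli_pmf p)) borel (\<lambda>x. a * of_bool x + b)"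

lemma prob_space_bernoulli_affine: "prob_space (bernoulli_affine p a b)"
  unfolding bernoulli_affine_def by (rule measure_pmf.prob_space_distr) simp

lemma sets_bernoulli_affine [simp]: "sets (bernoulli_affine p a b) = sets borel"
  by (simp add: bernoulli_affine_def)

lemma
  fixes g :: "real \<Rightarrow> real"
  assumes [measurable]: "g \<in> borel_measurable borel" and p: "0 \<le> p" "p \<le> 1"
  shows integrable_bernoulli_affine: "integrable (bernoulli_affine p a b) g"
    and integral_bernoulli_affine: "(\<integral>x. g x \<partial>bernoulli_affine p a b) = p * g (a + b) + (1 - p) * g b"
  using p unfolding bernoulli_affine_def
  by (auto simp: integrable_distr_eq integral_distr intro!: integrable_measure_pmf_finite)

text \<open>Realise the summands on a finite product of Bernoulli laws; the number of successes
  there is binomial.\<close>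

lemma conv_power_bernoulli_affine:
  assumes p: "0 \<le> p" "p \<le> 1"
  shows "conv_power (bernoulli_affine p a b) n
    = distr (measure_pmf (binomial_pmf n p)) borel (\<lambda>j. a * real j + real n * b)"
proof -
  define P where "P = Pi_pmf {..<n} False (\<lambda>_. bernoulli_pmf p)"
  define X where "X i f = a * of_bool (f i) + b" for i :: nat and f :: "nat \<Rightarrow> bool"
  have "prob_space.indep_vars (measure_pmf P) (\<lambda>_. count_space UNIV) (\<lambda>i f. f i) {..<n}"
    unfolding P_def by (rule indep_vars_Pi_pmf) simp
  hence indep: "prob_space.indep_vars (measure_pmf P) (\<lambda>_. borel) X {..<n}"
    unfolding X_def by (rule prob_space.indep_vars_compose2[OF measure_pmf.prob_space_axioms]) auto
  have dist: "distr (measure_pmf P) borel (X i) = bernoulli_affine p a b" if "i < n" for i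
  proof -
    have "distr (measure_pmf P) borel (X i)
        = distr (distr (measure_pmf P) (count_space UNIV) (\<lambda>f. f i)) borel (\<lambda>x. a * of_bool x + b)"
      by (subst distr_distr) (auto simp: X_def[abs_def] comp_def)
    also have "distr (measure_pmf P) (count_space UNIV) (\<lambda>f. f i) = measure_pmf (map_pmf (\<lambda>f. f i) P)"
      by (simp add: map_pmf_rep_eq)
    also have "map_pmf (\<lambda>f. f i) P = bernoulli_pmf p"
      unfolding P_def using that by (subst Pi_pmf_component) auto
    finally show ?thesis by (simp add: bernoulli_affine_def)
  qed
  have "conv_power (bernoulli_affine p a b) n = distr (measure_pmf P) borel (\<lambda>f. \<Sum>i<n. X i f)"
    using prob_space.distr_iid_sum[OF measure_pmf.prob_space_axioms indep dist] by simp
  also have "(\<lambda>f. \<Sum>i<n. X i f) = (\<lambda>j. a * real j + real n * b) \<circ> (\<lambda>f. card {i\<in>{..<n}. f i})"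
    by (auto simp: X_def fun_eq_iff sum.distrib sum_distrib_left[symmetric] of_bool_def sum.If_cases Int_def)
  also have "distr (measure_pmf P) borel \<dots>
      = distr (distr (measure_pmf P) (count_space UNIV) (\<lambda>f. card {i\<in>{..<n}. f i})) borel
          (\<lambda>j. a * real j + real n * b)"
    by (subst distr_distr) auto
  also have "distr (measure_pmf P) (count_space UNIV) (\<lambda>f. card {i\<in>{..<n}. f i}) = measure_pmf (binomial_pmf n p)"
    using p binomial_pmf_altdef'[of "{..<n}" n p False] by (simp add: P_def map_pmf_rep_eq)
  finally show ?thesis .
qed

lemma (in prob_space) distr_indicator_valued:
  assumes [measurable]: "Y \<in> borel_measurable M" and Y: "\<And>\<omega>. \<omega> \<in> space M \<Longrightarrow> Y \<omega> \<in> {0, 1}"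
    and p: "prob {\<omega> \<in> space M. Y \<omega> = 1} = p"
  shows "distr M borel Y = bernoulli_affine p 1 0"
proof -
  have p01: "0 \<le> p" "p \<le> 1" using p[symmetric] by auto
  have "distr M (count_space UNIV) (\<lambda>\<omega>. Y \<omega> = 1) = measure_pmf (bernoulli_pmf p)"
  proof (rule measure_eqI_finite[where A=UNIV])
    fix b :: bool
    have T: "{\<omega> \<in> space M. Y \<omega> = 1} \<in> events" by measurable
    have "prob {\<omega> \<in> space M. Y \<omega> \<noteq> 1} = prob (space M - {\<omega> \<in> space M. Y \<omega> = 1})"
      by (intro arg_cong[where f=prob]) auto
    also have "\<dots> = 1 - p" using prob_compl[OF T] p by simp
    finally have "prob {\<omega> \<in> space M. (Y \<omega> = 1) = b} = pmf (bernoulli_pmf p) b"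
      using p p01 by (cases b) auto
    moreover have "(\<lambda>\<omega>. Y \<omega> = 1) -` {b} \<inter> space M = {\<omega> \<in> space M. (Y \<omega> = 1) = b}" by auto
    ultimately show "emeasure (distr M (count_space UNIV) (\<lambda>\<omega>. Y \<omega> = 1)) {b} = emeasure (bernoulli_pmf p) {b}"
      by (simp add: emeasure_distr emeasure_eq_measure emeasure_pmf_single)
  qed auto
  hence "bernoulli_affine p 1 0
      = distr (distr M (count_space UNIV) (\<lambda>\<omega>. Y \<omega> = 1)) borel (\<lambda>x. of_bool x)"
    by (simp add: bernoulli_affine_def)
  also have "\<dots> = distr M borel (\<lambda>\<omega>. of_bool (Y \<omega> = 1))"
    by (subst distr_distr) (auto simp: comp_def)
  also have "\<dots> = distr M borel Y"
    using Y by (intro distr_cong) (auto simp: of_bool_def)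
  finally show ?thesis by simp
qed

lemma (in prob_space) prob_bernoulli_sum:
  fixes X :: "nat \<Rightarrow> 'a \<Rightarrow> real"
  assumes "indep_vars (\<lambda>_. borel) X UNIV" "\<And>i \<omega>. \<omega> \<in> space M \<Longrightarrow> X i \<omega> \<in> {0, 1}"
    and "\<And>i. prob {\<omega> \<in> space M. X i \<omega> = 1} = p" and A: "A \<in> sets borel"
  shows "prob {\<omega> \<in> space M. (\<Sum>i<n. X i \<omega>) \<in> A} = measure_pmf.prob (binomial_pmf n p) {j. real j \<in> A}"
proof -
  have p01: "0 \<le> p" "p \<le> 1" using assms(3)[of 0, symmetric] by auto
  have [measurable]: "X i \<in> borel_measurable M" for i
    using assms(1) by (auto simp: indep_vars_def)
  have S: "(\<lambda>\<omega>. \<Sum>i<n. X i \<omega>) \<in> borel_measurable M" by measurable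
  have "distr M borel (\<lambda>\<omega>. \<Sum>i<n. X i \<omega>) = conv_power (bernoulli_affine p 1 0) n"
  proof (rule distr_iid_sum)
    show "indep_vars (\<lambda>_. borel) X {..<n}" using assms(1) by (rule indep_vars_subset) simp
  qed (use assms(2,3) distr_indicator_valued in auto)
  hence eq: "distr M borel (\<lambda>\<omega>. \<Sum>i<n. X i \<omega>) = distr (measure_pmf (binomial_pmf n p)) borel real"
    using p01 by (simp add: conv_power_bernoulli_affine)
  have "prob {\<omega> \<in> space M. (\<Sum>i<n. X i \<omega>) \<in> A} = measure (distr M borel (\<lambda>\<omega>. \<Sum>i<n. X i \<omega>)) A"
    using A S by (subst measure_distr) (auto intro!: arg_cong[where f=prob])
  also have "\<dots> = measure_pmf.prob (binomial_pmf n p) {j. real j \<in> A}"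
    unfolding eq using A by (subst measure_distr) (auto simp: vimage_def)
  finally show ?thesis .
qed

section \<open>The Berry--Esseen inequality for binomial laws\<close>

lemma
  assumes \<theta>: "0 < \<theta>" "\<theta> < 1" and c: "\<bar>c\<bar> = 1"
  shows bernoulli_centred_mean: "(\<integral>y. y \<partial>bernoulli_affine \<theta> c (- c * \<theta>)) = 0"
    and bernoulli_centred_variance: "(\<integral>y. y\<^sup>2 \<partial>bernoulli_affine \<theta> c (- c * \<theta>)) = \<theta> * (1 - \<theta>)"
    and bernoulli_centred_moment3: "(\<integral>y. \<bar>y\<bar> ^ 3 \<partial>bernoulli_affine \<theta> c (- c * \<theta>)) =
      \<theta> * (1 - \<theta>) * (\<theta>\<^sup>2 + (1 - \<theta>)\<^sup>2)"
proof -
  have c: "c = 1 \<or> c = -1" using c by linarith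
  show "(\<integral>y. y \<partial>bernoulli_affine \<theta> c (- c * \<theta>)) = 0"
    using c \<theta> by (subst integral_bernoulli_affine) (auto simp: algebra_simps)
  show "(\<integral>y. y\<^sup>2 \<partial>bernoulli_affine \<theta> c (- c * \<theta>)) = \<theta> * (1 - \<theta>)"
    using c \<theta> by (subst integral_bernoulli_affine) (auto simp: algebra_simps power2_eq_square)
  have "\<bar>1 - \<theta>\<bar> = 1 - \<theta>" "\<bar>\<theta> - 1\<bar> = 1 - \<theta>" "\<bar>- \<theta>\<bar> = \<theta>" "\<bar>\<theta>\<bar> = \<theta>" using \<theta> by auto
  thus "(\<integral>y. \<bar>y\<bar> ^ 3 \<partial>bernoulli_affine \<theta> c (- c * \<theta>)) = \<theta> * (1 - \<theta>) * (\<theta>\<^sup>2 + (1 - \<theta>)\<^sup>2)"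
    using c \<theta> by (subst integral_bernoulli_affine) (auto simp: algebra_simps power2_eq_square power3_eq_cube)
qed

text \<open>Evaluate the inequality at 0, where \<open>Phi\<close> is 1/2. It speaks of closed lower
  tails only; reflecting the centred variable (c = -1) yields the closed upper tail.\<close>

lemma BE_valid_bernoulli:
  assumes "BE_valid C" and \<theta>: "0 < \<theta>" "\<theta> < 1" and n: "n \<ge> 1" and c: "\<bar>c\<bar> = 1"
  shows "\<bar>measure_pmf.prob (binomial_pmf n \<theta>) {j. c * real j \<le> c * (real n * \<theta>)} - 1 / 2\<bar>
    \<le> C / sqrt (real n) * (\<theta> * (1 - \<theta>) * (\<theta>\<^sup>2 + (1 - \<theta>)\<^sup>2) / (\<theta> * (1 - \<theta>)) powr (3/2))"
proof -
  define Q where "Q = bernoulli_affine \<theta> c (- c * \<theta>)"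
  define s where "s = sqrt (real n * (\<theta> * (1 - \<theta>)))"
  have s: "s > 0" using n \<theta> by (simp add: s_def)
  have Q: "prob_space Q" "sets Q = sets borel" "integrable Q (\<lambda>y. \<bar>y\<bar> ^ 3)"
    unfolding Q_def using \<theta> by (auto intro: prob_space_bernoulli_affine integrable_bernoulli_affine)
  have moments: "(\<integral>y. y \<partial>Q) = 0" "(\<integral>y. y\<^sup>2 \<partial>Q) = \<theta> * (1 - \<theta>)"
    "(\<integral>y. \<bar>y\<bar> ^ 3 \<partial>Q) = \<theta> * (1 - \<theta>) * (\<theta>\<^sup>2 + (1 - \<theta>)\<^sup>2)"
    unfolding Q_def using bernoulli_centred_mean bernoulli_centred_variance bernoulli_centred_moment3 \<theta> c by auto
  have "measure (distr (PiM {..<n} (\<lambda>_. Q)) borel (\<lambda>x. (\<Sum>i<n. x i) / s)) {..0}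
      = measure (conv_power Q n) {..0}"
    using measure_distr_PiM_scaled_sum[OF Q(1,2) n s, of 0] by simp
  also have "\<dots> = measure_pmf.prob (binomial_pmf n \<theta>) {j. c * real j \<le> c * (real n * \<theta>)}"
    unfolding Q_def using \<theta> by (subst conv_power_bernoulli_affine)
      (auto simp: measure_distr vimage_def algebra_simps)
  finally have eq: "measure (distr (PiM {..<n} (\<lambda>_. Q)) borel (\<lambda>x. (\<Sum>i<n. x i) / s)) {..0}
    = measure_pmf.prob (binomial_pmf n \<theta>) {j. c * real j \<le> c * (real n * \<theta>)}" .
  have "\<bar>measure (distr (PiM {..<n} (\<lambda>_. Q)) borel (\<lambda>x. (\<Sum>i<n. x i) / sqrt (real n * (\<integral>y. y\<^sup>2 \<partial>Q)))) {..0} - Phi 0\<bar>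
      \<le> C / sqrt (real n) * ((\<integral>y. \<bar>y\<bar> ^ 3 \<partial>Q) / (\<integral>y. y\<^sup>2 \<partial>Q) powr (3/2))"
    using assms(1)[unfolded BE_valid_def, rule_format, of Q n 0] Q moments n \<theta> by simp
  thus ?thesis
    unfolding moments s_def[symmetric] eq Phi_0 .
qed

text \<open>One fair coin toss already bounds an absolute value by a positive multiple of
  \<open>C\<close>. This makes the set defining \<open>C_BE\<close> bounded below.\<close>

lemma BE_valid_nonneg:
  assumes "BE_valid C"
  shows "0 \<le> C"
proof -
  have "0 \<le> C * ((1/8 :: real) / (1/4) powr (3/2))"
    using order_trans[OF abs_ge_zero BE_valid_bernoulli[OF assms, of "1/2" 1 1]] by (simp add: power2_eq_square)
  moreover have "(1/8 :: real) / (1/4) powr (3/2) > 0" by simp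
  ultimately show ?thesis by (simp only: zero_le_mult_iff) linarith
qed

text \<open>The infimum is itself admissible: every single inequality is of the form
  \<open>a \<le> C / s * b\<close> with \<open>b \<ge> 0\<close>, hence closed under passing to the
  infimum over \<open>C\<close>.\<close>

lemma BE_valid_C_BE: "BE_valid C_BE"
proof -
  define S where "S = {C. BE_valid C}"
  have S: "S \<noteq> {}" "bdd_below S"
    using BE_valid_84 BE_valid_nonneg by (auto simp: S_def intro!: bdd_belowI[of _ 0])
  have Inf_bound: "a \<le> C_BE / s * b" if "\<And>C. C \<in> S \<Longrightarrow> a \<le> C / s * b" "0 \<le> b" "0 < s" for a b s :: real
  proof (cases "b = 0")
    case True
    thus ?thesis using that S(1) by fastforce
  next
    case False
    hence b: "b > 0" using that by simp
    have "a * s / b \<le> C" if "C \<in> S" for C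
      using \<open>\<And>C. C \<in> S \<Longrightarrow> a \<le> C / s * b\<close>[OF that] b \<open>0 < s\<close> by (simp add: field_simps)
    hence "a * s / b \<le> Inf S" using S(1) by (intro cInf_greatest)
    thus ?thesis using b \<open>0 < s\<close> by (simp add: C_BE_def S_def field_simps)
  qed
  show ?thesis
    unfolding BE_valid_def
    by (intro allI impI Inf_bound) (auto simp: S_def BE_valid_def)
qed

lemma C_BE_nonneg: "0 \<le> C_BE"
  using BE_valid_C_BE by (rule BE_valid_nonneg)

text \<open>The ratio of third moment to cubed deviation is
  \<open>(\<theta>^2 + (1 - \<theta>)^2) / sqrt v\<close>, and the numerator is at most 1.\<close>

lemma binomial_prob_beyond_mean_le:
  assumes \<theta>: "0 < \<theta>" "\<theta> < 1" and n: "n \<ge> 1" and c: "\<bar>c\<bar> = 1"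
  shows "measure_pmf.prob (binomial_pmf n \<theta>) {j. c * real j \<le> c * (real n * \<theta>)}
    \<le> 1 / 2 + C_BE / sqrt (real n * (\<theta> * (1 - \<theta>)))"
proof -
  define v where "v = \<theta> * (1 - \<theta>)"
  have v: "v > 0" using \<theta> by (simp add: v_def)
  have "\<theta>\<^sup>2 + (1 - \<theta>)\<^sup>2 = 1 - 2 * v" by (simp add: v_def power2_eq_square algebra_simps)
  hence le1: "\<theta>\<^sup>2 + (1 - \<theta>)\<^sup>2 \<le> 1" using v by simp
  have "v powr (3/2) = v powr (1 + 1/2)" by simp
  also have "\<dots> = v * sqrt v" using v by (simp only: powr_add) (simp add: powr_half_sqrt)
  finally have "v * (\<theta>\<^sup>2 + (1 - \<theta>)\<^sup>2) / v powr (3/2) = (\<theta>\<^sup>2 + (1 - \<theta>)\<^sup>2) / sqrt v"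
    using v by simp
  also have "\<dots> \<le> 1 / sqrt v" using le1 v by (intro divide_right_mono) auto
  finally have "C_BE / sqrt (real n) * (v * (\<theta>\<^sup>2 + (1 - \<theta>)\<^sup>2) / v powr (3/2)) \<le> C_BE / sqrt (real n) * (1 / sqrt v)"
    using C_BE_nonneg by (intro mult_left_mono) auto
  also have "\<dots> = C_BE / sqrt (real n * v)"
    by (simp add: real_sqrt_mult)
  finally show ?thesis
    using BE_valid_bernoulli[OF BE_valid_C_BE \<theta> n c] unfolding v_def by linarith
qed

section \<open>Chernoff bounds for binomial tails\<close>

text \<open>Markov's bound for u^S with S binomial with parameters \<open>k\<close> and
  \<open>p\<close>: the numerator is the expectation of u^S.\<close>

definition chernoff_bound :: "nat \<Rightarrow> nat \<Rightarrow> real \<Rightarrow> real \<Rightarrow> real" where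
  "chernoff_bound k g p u = (1 - p + p * u) ^ k / u ^ g"

text \<open>A tail of the binomial distribution is written \<open>{j. c * real j \<le> c * real g}\<close>, which is the
  lower tail for \<open>c = 1\<close> and the upper tail for \<open>c = -1\<close>.\<close>

lemma binomial_tilt:
  assumes p: "0 < p" "p < 1" and u: "0 < u" "c * u \<le> c" and c: "\<bar>c\<bar> = 1"
  defines "\<theta> \<equiv> p * u / (1 - p + p * u)"
  shows "measure_pmf.prob (binomial_pmf k p) {j. c * real j \<le> c * real g}
    \<le> chernoff_bound k g p u * measure_pmf.prob (binomial_pmf k \<theta>) {j. c * real j \<le> c * real g}"
proof -
  define d where "d = 1 - p + p * u"
  have d: "d > 0" unfolding d_def using p u by (intro add_pos_pos mult_pos_pos) auto
  have \<theta>: "0 < \<theta>" "\<theta> = p * u / d" "1 - \<theta> = (1 - p) / d"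
  proof -
    show "\<theta> = p * u / d" by (simp add: \<theta>_def d_def)
    thus "0 < \<theta>" using p u d by simp
    have "1 - \<theta> = (d - p * u) / d" using d by (simp add: \<open>\<theta> = p * u / d\<close> diff_divide_distrib)
    thus "1 - \<theta> = (1 - p) / d" by (simp add: d_def)
  qed
  have \<theta>1: "\<theta> < 1" using \<theta>(3) p d by (metis diff_gt_0_iff_gt divide_pos_pos)
  define A where "A = {j. c * real j \<le> c * real g} \<inter> {..k}"
  have fin: "finite A" by (simp add: A_def)
  have prob: "measure_pmf.prob (binomial_pmf k q) {j. c * real j \<le> c * real g} = (\<Sum>j\<in>A. pmf (binomial_pmf k q) j)"
    if "0 < q" "q < 1" for q
  proof -
    have "measure_pmf.prob (binomial_pmf k q) {j. c * real j \<le> c * real g}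
        = measure_pmf.prob (binomial_pmf k q) ({j. c * real j \<le> c * real g} \<inter> set_pmf (binomial_pmf k q))"
      by (rule measure_Int_set_pmf[symmetric])
    also have "\<dots> = (\<Sum>j\<in>A. pmf (binomial_pmf k q) j)"
      using that fin by (simp add: A_def measure_measure_pmf_finite)
    finally show ?thesis .
  qed
  have "pmf (binomial_pmf k p) j \<le> chernoff_bound k g p u * pmf (binomial_pmf k \<theta>) j" if j: "j \<in> A" for j
  proof -
    have jk: "j \<le> k" and cj: "c * real j \<le> c * real g" using j by (auto simp: A_def)
    have "c = 1 \<or> c = -1" using c by linarith
    \<comment> \<open>The condition \<open>c * u \<le> c\<close> means \<open>u \<le> 1\<close> for
      the lower tail and \<open>u \<ge> 1\<close> for the upper one; either way the power is
      smallest at the edge \<open>g\<close> of the tail.\<close>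
    hence ug: "u ^ g \<le> u ^ j"
    proof
      assume "c = 1"
      thus ?thesis using u cj by (intro power_decreasing) auto
    next
      assume "c = -1"
      thus ?thesis using u cj by (intro power_increasing) auto
    qed
    have split: "d ^ k = d ^ j * d ^ (k - j)" using jk by (simp flip: power_add)
    \<comment> \<open>The tilted weight is \<open>u ^ j / d ^ k\<close> times the original
      one.\<close>
    have "d ^ k * pmf (binomial_pmf k \<theta>) j = real (k choose j) * (d ^ j * \<theta> ^ j) * (d ^ (k - j) * (1 - \<theta>) ^ (k - j))"
      using \<theta>(1) \<theta>1 by (simp add: split)
    also have "\<dots> = real (k choose j) * (p * u) ^ j * (1 - p) ^ (k - j)"
    proof -
      have "d * \<theta> = p * u" "d * (1 - \<theta>) = 1 - p" unfolding \<theta>(2) using \<theta>(2,3) d by simp_all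
      thus ?thesis by (simp only: power_mult_distrib[symmetric])
    qed
    also have "\<dots> = u ^ j * pmf (binomial_pmf k p) j"
      using p by (simp add: power_mult_distrib)
    finally have "u ^ g * pmf (binomial_pmf k p) j \<le> d ^ k * pmf (binomial_pmf k \<theta>) j"
      using mult_right_mono[OF ug pmf_nonneg[of "binomial_pmf k p" j]] by simp
    thus ?thesis using u(1) by (simp add: chernoff_bound_def d_def field_simps)
  qed
  thus ?thesis
    unfolding prob[OF p] prob[OF \<theta>(1) \<theta>1] sum_distrib_left by (rule sum_mono)
qed

lemma chernoff_bound_nonneg: "0 < p \<Longrightarrow> p < 1 \<Longrightarrow> 0 < u \<Longrightarrow> 0 \<le> chernoff_bound k g p u"
  by (simp add: chernoff_bound_def)

lemma binomial_tail_le_chernoff: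
  assumes p: "0 < p" "p < 1" and u: "0 < u" "c * u \<le> c" and c: "\<bar>c\<bar> = 1"
  shows "measure_pmf.prob (binomial_pmf k p) {j. c * real j \<le> c * real g} \<le> chernoff_bound k g p u"
  using order_trans[OF binomial_tilt[OF p u c] mult_left_le[OF measure_pmf.prob_le_1 chernoff_bound_nonneg[OF p u(1)]]] .

text \<open>The tilt that moves the mean to \<open>g\<close> minimises the Chernoff bound.\<close>

lemma chernoff_bound_min:
  fixes g k :: nat
  assumes p: "0 < p" "p < 1" and g: "0 < g" "g < k" and v: "0 < v"
  shows "chernoff_bound k g p (real g * (1 - p) / ((real k - real g) * p)) \<le> chernoff_bound k g p v"
proof -
  define u where "u = real g * (1 - p) / ((real k - real g) * p)"
  define \<theta> where "\<theta> = real g / real k"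
  have u: "u > 0" using p g by (simp add: u_def)
  have \<theta>: "0 < \<theta>" "\<theta> < 1" "real k * \<theta> = real g" using g by (auto simp: \<theta>_def)
  define w where "w = v / u"
  have w: "w > 0" "v = w * u" using u v by (auto simp: w_def)
  define t where "t = 1 - \<theta> + \<theta> * w"
  have t: "t > 0" unfolding t_def using \<theta> w by (intro add_pos_pos) auto
  have D: "1 - p + p * u = (1 - p) * real k / (real k - real g)"
    using p g by (simp add: u_def field_simps)
  \<comment> \<open>Passing from the optimal \<open>u\<close> to \<open>v = w * u\<close> multiplies
    the normalising factor by \<open>t\<close>, the mean of w^B for a Bernoulli variable B with
    parameter \<theta>.\<close>
  have Dv: "1 - p + p * v = (1 - p + p * u) * t"
  proof -
    have "p * u = (1 - p) * real g / (real k - real g)" using p g by (simp add: u_def)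
    moreover have "p * v = w * (p * u)" by (simp add: w(2))
    ultimately have "p * v = w * ((1 - p) * real g / (real k - real g))" by simp
    hence "1 - p + p * v = (1 - p) * (1 + real g * w / (real k - real g))"
      by (simp add: algebra_simps)
    also have "1 + real g * w / (real k - real g) = (real k * t) / (real k - real g)"
    proof -
      have "real k * t = (real k - real g) + real g * w"
        using g by (simp add: t_def \<theta>_def field_simps)
      thus ?thesis using g by (simp add: add_divide_distrib)
    qed
    finally show ?thesis unfolding D by simp
  qed
  \<comment> \<open>Weighted arithmetic-geometric mean inequality for \<open>w\<close> and 1,
    obtained from \<open>ln x \<le> x - 1\<close> at \<open>w / t\<close> and
    \<open>1 / t\<close>.\<close>
  have "\<theta> * ln w \<le> ln t"
  proof -
    have "\<theta> * ln (w / t) \<le> \<theta> * (w / t - 1)" "(1 - \<theta>) * ln (1 / t) \<le> (1 - \<theta>) * (1 / t - 1)"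
      using \<theta> w t by (auto intro!: mult_left_mono ln_le_minus_one)
    moreover have "\<theta> * (w / t - 1) + (1 - \<theta>) * (1 / t - 1) = 0"
      using t by (simp add: field_simps) (simp add: t_def algebra_simps)
    moreover have "\<theta> * ln (w / t) + (1 - \<theta>) * ln (1 / t) = \<theta> * ln w - ln t"
      using w t by (simp add: ln_div algebra_simps)
    ultimately show ?thesis by linarith
  qed
  hence "real k * (\<theta> * ln w) \<le> real k * ln t" by (intro mult_left_mono) auto
  hence "real g * ln w \<le> real k * ln t"
    unfolding \<theta>(3)[symmetric] by (simp only: mult.assoc)
  hence "ln (w ^ g) \<le> ln (t ^ k)" using w t by (simp add: ln_realpow)
  hence wt: "w ^ g \<le> t ^ k" using w t by simp
  have "chernoff_bound k g p v = chernoff_bound k g p u * (t ^ k / w ^ g)"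
    unfolding chernoff_bound_def Dv by (simp add: w(2) power_mult_distrib)
  moreover have "1 \<le> t ^ k / w ^ g" using wt w by simp
  ultimately show ?thesis
    using mult_left_mono[of 1 "t ^ k / w ^ g" "chernoff_bound k g p u"] chernoff_bound_nonneg[OF p u, of k g]
    by (simp add: u_def)
qed

text \<open>Tilting to \<theta> = g/k puts the mean at \<open>g\<close>, so the tilted tail is about
  1/2, with variance reciprocal \<open>1 / g + 1 / (k - g)\<close>. The hypothesis \<open>cg\<close>
  puts the tilt on the side of 1 that \<open>binomial_tilt\<close> asks for. Being optimal, its
  Chernoff factor may be replaced by that of any \<open>v\<close>.\<close>

lemma binomial_tail_le_half_chernoff:
  fixes g k :: nat
  assumes p: "0 < p" "p < 1" and g: "0 < g" "g < k" and v: "0 < v" and c: "\<bar>c\<bar> = 1"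
    and cg: "c * real g \<le> c * (real k * p)"
  shows "measure_pmf.prob (binomial_pmf k p) {j. c * real j \<le> c * real g}
    \<le> chernoff_bound k g p v * (1 / 2 + C_BE * sqrt (1 / real g + 1 / (real k - real g)))"
proof -
  define u where "u = real g * (1 - p) / ((real k - real g) * p)"
  have u: "u > 0" using p g by (simp add: u_def)
  have "u - 1 = (real g - real k * p) / ((real k - real g) * p)"
    using p g by (simp add: u_def field_simps)
  hence "c * (u - 1) = (c * real g - c * (real k * p)) / ((real k - real g) * p)"
    by (simp add: algebra_simps)
  also have "\<dots> \<le> 0" using p g cg by (intro divide_nonpos_pos) auto
  finally have cu: "c * u \<le> c" by (simp add: algebra_simps)
  define \<theta> where "\<theta> = real g / real k"
  have \<theta>: "0 < \<theta>" "\<theta> < 1" "real k * \<theta> = real g" using g by (auto simp: \<theta>_def)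
  have D: "1 - p + p * u = (1 - p) * real k / (real k - real g)"
    using p g by (simp add: u_def field_simps)
  have pu: "p * u / (1 - p + p * u) = \<theta>"
    unfolding D using p g by (simp add: u_def \<theta>_def)
  define b where "b = 1 / 2 + C_BE * sqrt (1 / real g + 1 / (real k - real g))"
  have b: "b \<ge> 0" using C_BE_nonneg g by (simp add: b_def)
  have "1 / (real k * (\<theta> * (1 - \<theta>))) = 1 / real g + 1 / (real k - real g)"
    using g by (simp add: \<theta>_def field_simps)
  hence "C_BE / sqrt (real k * (\<theta> * (1 - \<theta>))) = C_BE * sqrt (1 / real g + 1 / (real k - real g))"
    by (simp flip: real_sqrt_divide add: divide_inverse real_sqrt_inverse[symmetric])
  hence half: "measure_pmf.prob (binomial_pmf k \<theta>) {j. c * real j \<le> c * real g} \<le> b"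
    using binomial_prob_beyond_mean_le[OF \<theta>(1,2) _ c, of k] g by (simp add: \<theta>(3) b_def)
  have "measure_pmf.prob (binomial_pmf k p) {j. c * real j \<le> c * real g}
      \<le> chernoff_bound k g p u * measure_pmf.prob (binomial_pmf k \<theta>) {j. c * real j \<le> c * real g}"
    using binomial_tilt[OF p u cu c] by (simp only: pu)
  also have "\<dots> \<le> chernoff_bound k g p v * b"
    using half b chernoff_bound_min[OF p g v] chernoff_bound_nonneg[OF p v]
    by (intro mult_mono) (auto simp: u_def)
  finally show ?thesis by (simp add: b_def)
qed

subsection \<open>The Poisson exponent\<close>

text \<open>The large-deviation rate of a Poisson variable of mean 1 at \<open>1 + e\<close>,
  divided by \<open>1 + e\<close>, that is, the exponent per success. Negative arguments describe
  the lower tail.\<close>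

definition poisson_rate :: "real \<Rightarrow> real" where
  "poisson_rate e = ln (1 + e) - e / (1 + e)"

lemma poisson_rate_pos:
  assumes "e > 0"
  shows "0 < poisson_rate e"
proof -
  have "ln (1 / (1 + e)) \<le> 1 / (1 + e) - 1" "ln (1 / (1 + e)) \<noteq> 1 / (1 + e) - 1"
    using assms ln_le_minus_one[of "1 / (1 + e)"] ln_eq_minus_one[of "1 / (1 + e)"] by auto
  hence "ln (1 / (1 + e)) < 1 / (1 + e) - 1" by linarith
  moreover have "ln (1 / (1 + e)) = - ln (1 + e)" using assms by (simp add: ln_div)
  moreover have "1 / (1 + e) - 1 = - (e / (1 + e))" using assms by (simp add: field_simps)
  ultimately show ?thesis by (simp add: poisson_rate_def)
qed

lemma DERIV_poisson_rate:
  assumes "1 + e > 0"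
  shows "(poisson_rate has_real_derivative e / (1 + e)\<^sup>2) (at e)"
proof -
  have "(poisson_rate has_real_derivative 1 / (1 + e) - (1 * (1 + e) - e * 1) / ((1 + e) * (1 + e))) (at e)"
    unfolding poisson_rate_def using assms by (auto intro!: derivative_eq_intros)
  moreover have "1 / s - (1 * s - e * 1) / (s * s) = e / s\<^sup>2" if "s > 0" for s
    using that by (simp add: power2_eq_square diff_divide_distrib)
  ultimately show ?thesis using assms by metis
qed

text \<open>Both sides vanish at 0 and the derivative \<open>e / (1 + e)^2\<close> is at most
  \<open>e\<close>. This turns the threshold on the sample size into a lower bound by
  \<open>m\<close>.\<close>

lemma poisson_rate_le:
  assumes "e > 0"
  shows "poisson_rate e \<le> e\<^sup>2 / 2"
proof -
  have "0\<^sup>2 / 2 - poisson_rate 0 \<le> e\<^sup>2 / 2 - poisson_rate e"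
  proof (rule DERIV_nonneg_imp_nondecreasing[where f="\<lambda>x. x\<^sup>2 / 2 - poisson_rate x" and a=0 and b=e])
    fix x assume x: "0 \<le> x" "x \<le> e"
    have "1 \<le> (1 + x)\<^sup>2" using x by (intro one_le_power) auto
    hence "x / (1 + x)\<^sup>2 \<le> x / 1" using x by (intro divide_left_mono) auto
    hence "x / (1 + x)\<^sup>2 \<le> x" by simp
    moreover have "((\<lambda>x. x\<^sup>2 / 2 - poisson_rate x) has_real_derivative x - x / (1 + x)\<^sup>2) (at x)"
      using x by (auto intro!: derivative_eq_intros DERIV_poisson_rate)
    ultimately show "\<exists>y. ((\<lambda>x. x\<^sup>2 / 2 - poisson_rate x) has_real_derivative y) (at x) \<and> 0 \<le> y"
      by (metis diff_ge_0_iff_ge)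
  qed (use assms in auto)
  thus ?thesis by (simp add: poisson_rate_def)
qed

text \<open>Compare the derivatives \<open>x / (1 - x)^2\<close> and \<open>x / (1 + x)^2\<close>.
  Hence the exponent at \<open>e\<close> serves for both tails.\<close>

lemma poisson_rate_uminus_ge:
  assumes "0 < e" "e < 1"
  shows "poisson_rate e \<le> poisson_rate (- e)"
proof -
  have "poisson_rate (- 0) - poisson_rate 0 \<le> poisson_rate (- e) - poisson_rate e"
  proof (rule DERIV_nonneg_imp_nondecreasing[where f="\<lambda>x. poisson_rate (- x) - poisson_rate x" and a=0 and b=e])
    fix x assume x: "0 \<le> x" "x \<le> e"
    have "(1 - x)\<^sup>2 \<le> (1 + x)\<^sup>2" using x by (simp add: power2_eq_square algebra_simps)
    hence "x / (1 + x)\<^sup>2 \<le> x / (1 - x)\<^sup>2" using x assms by (intro divide_left_mono) auto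
    moreover have "((\<lambda>x. poisson_rate (- x)) has_real_derivative (- x / (1 + - x)\<^sup>2) * (- 1)) (at x)"
      using x assms by (intro DERIV_chain2[of poisson_rate] DERIV_poisson_rate) (auto intro!: derivative_eq_intros)
    hence "((\<lambda>x. poisson_rate (- x) - poisson_rate x) has_real_derivative x / (1 - x)\<^sup>2 - x / (1 + x)\<^sup>2) (at x)"
      using x by (auto intro!: derivative_eq_intros DERIV_poisson_rate)
    ultimately show "\<exists>y. ((\<lambda>x. poisson_rate (- x) - poisson_rate x) has_real_derivative y) (at x) \<and> 0 \<le> y"
      by (metis diff_ge_0_iff_ge)
  qed (use assms in auto)
  thus ?thesis by (simp add: poisson_rate_def)
qed

text \<open>Use 1 + pe \<le> exp(pe). Multiplying the condition on \<open>k\<close> by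
  \<open>e\<close> lets one statement cover both signs: \<open>k\<close> is at most the threshold
  for e > 0 and at least the threshold for e < 0.\<close>

lemma chernoff_bound_le_poisson:
  fixes g k :: nat
  assumes p: "0 < p" "p < 1" and e: "-1 < e" and ek: "e * real k \<le> e * (real g / ((1 + e) * p))"
  shows "chernoff_bound k g p (1 + e) \<le> exp (- real g * poisson_rate e)"
proof -
  have "p * (e * real k) \<le> p * (e * (real g / ((1 + e) * p)))"
    by (rule mult_left_mono[OF ek]) (use p in simp)
  also have "\<dots> = real g * (e / (1 + e))" using p by simp
  finally have kpe: "real k * (p * e) \<le> real g * (e / (1 + e))" by (simp add: mult_ac)
  have "0 < (1 - p) + p * (1 + e)" using p e by (intro add_pos_pos) auto
  hence "0 \<le> 1 + p * e" by (simp add: algebra_simps)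
  hence "(1 + p * e) ^ k \<le> exp (p * e) ^ k" by (intro power_mono) auto
  also have "\<dots> = exp (real k * (p * e))" by (simp add: exp_of_nat_mult)
  also have "\<dots> \<le> exp (real g * (e / (1 + e)))" using kpe by simp
  finally have 1: "(1 + p * e) ^ k \<le> exp (real g * (e / (1 + e)))" .
  have 2: "(1 + e) ^ g = exp (real g * ln (1 + e))" using e by (simp add: exp_of_nat_mult)
  have "chernoff_bound k g p (1 + e) = (1 + p * e) ^ k / (1 + e) ^ g"
    by (simp add: chernoff_bound_def algebra_simps)
  also have "\<dots> \<le> exp (real g * (e / (1 + e))) / exp (real g * ln (1 + e))"
    unfolding 2 using 1 by (intro divide_right_mono) auto
  also have "\<dots> = exp (- real g * poisson_rate e)"
    by (simp add: poisson_rate_def exp_diff[symmetric] algebra_simps)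
  finally show ?thesis .
qed

subsection \<open>The binary relative entropy\<close>

definition bernoulli_KL :: "real \<Rightarrow> real \<Rightarrow> real" where
  "bernoulli_KL q p = q * ln (q / p) + (1 - q) * ln ((1 - q) / (1 - p))"

text \<open>The difference \<open>F\<close> of the two sides, as a function of the second argument,
  vanishes at \<open>q\<close> and has derivative \<open>- (q - x) * B x\<close> with
  \<open>B x \<ge> 0\<close>. So it falls up to \<open>q\<close> and rises afterwards, and
  \<open>q\<close> is its minimum.\<close>

lemma bernoulli_KL_ge:
  assumes p: "0 < p" "p < 1" and q: "0 < q" "q < 1"
  shows "(q - p)\<^sup>2 / (2 * ((2 * p + q) / 3) * (1 - (2 * p + q) / 3)) \<le> bernoulli_KL q p"
proof -
  define w where "w x = (2 * x + q) / 3" for x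
  define F where "F x = bernoulli_KL q x - (q - x)\<^sup>2 / (2 * w x * (1 - w x))" for x
  define B where "B x = 1 / (x * (1 - x)) - 1 / (w x * (1 - w x))
      - (q - x) * (1 - 2 * w x) / (3 * (w x * (1 - w x))\<^sup>2)" for x
  have w: "0 < w x" "w x < 1" if "0 < x" "x < 1" for x
    using that q by (auto simp: w_def)
  have deriv: "(F has_real_derivative - ((q - x) * B x)) (at x)" if x: "0 < x" "x < 1" for x
  proof -
    have dw: "(w has_real_derivative 2 / 3) (at x)"
      unfolding w_def by (auto intro!: derivative_eq_intros)
    have "((\<lambda>x. q * (ln q - ln x) + (1 - q) * (ln (1 - q) - ln (1 - x))) has_real_derivative
        q * (- (1 / x)) + (1 - q) * (1 / (1 - x))) (at x)"
      using x by (auto intro!: derivative_eq_intros)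
    hence d1: "(bernoulli_KL q has_real_derivative q * (- (1 / x)) + (1 - q) * (1 / (1 - x))) (at x)"
      by (rule has_field_derivative_transform_within_open[where S="{0<..<1}"])
        (use x q in \<open>auto simp: bernoulli_KL_def ln_div\<close>)
    have nz: "2 * w x * (1 - w x) \<noteq> 0" using w[OF x] by simp
    have d2: "((\<lambda>x. (q - x)\<^sup>2 / (2 * w x * (1 - w x))) has_real_derivative
        ((- 2 * (q - x)) * (2 * w x * (1 - w x)) - (q - x)\<^sup>2 * (2 * (2 / 3) * (1 - w x) + 2 * w x * (- (2 / 3))))
          / ((2 * w x * (1 - w x)) * (2 * w x * (1 - w x)))) (at x)"
      by (intro DERIV_divide nz) (auto intro!: derivative_eq_intros dw)
    have e1: "q * (- (1 / x)) + (1 - q) * (1 / (1 - x)) = - ((q - x) * (1 / (x * (1 - x))))"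
      using x by (simp add: field_simps)
    have e2: "((- 2 * (q - x)) * (2 * s * (1 - s)) - (q - x)\<^sup>2 * (2 * (2 / 3) * (1 - s) + 2 * s * (- (2 / 3))))
          / ((2 * s * (1 - s)) * (2 * s * (1 - s)))
        = - ((q - x) * (1 / (s * (1 - s)) + (q - x) * (1 - 2 * s) / (3 * (s * (1 - s))\<^sup>2)))"
      if "s \<noteq> 0" "1 - s \<noteq> 0" for s
      using that by (simp add: divide_simps power2_eq_square) (simp add: algebra_simps)
    have "(F has_real_derivative - ((q - x) * (1 / (x * (1 - x))))
        - (- ((q - x) * (1 / (w x * (1 - w x)) + (q - x) * (1 - 2 * w x) / (3 * (w x * (1 - w x))\<^sup>2))))) (at x)"
      unfolding F_def using DERIV_diff[OF d1 d2] w[OF x] by (simp only: e1) (subst (asm) e2, auto)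
    thus ?thesis by (simp add: B_def algebra_simps)
  qed
  have B: "0 \<le> B x" if x: "0 < x" "x < 1" for x
  proof -
    \<comment> \<open>Since \<open>x\<close> is \<open>w x - (q - x) / 3\<close>, the variance
      \<open>x * (1 - x)\<close> is a perturbation \<open>v - b\<close> of \<open>v\<close>, and
      1/(v - b) is bounded below by its first-order expansion at \<open>v\<close>.\<close>
    define v a b where "v = w x * (1 - w x)" and "a = (q - x) / 3 * (1 - 2 * w x)" and "b = a + ((q - x) / 3)\<^sup>2"
    have v: "v > 0" using w[OF x] by (simp add: v_def)
    have x_eq: "x * (1 - x) = v - b"
      by (simp add: v_def b_def a_def w_def power2_eq_square field_simps)
    have pos: "v - b > 0" using x by (simp flip: x_eq)
    have "(v - b) * (1 / v + b / v\<^sup>2) = 1 - (b / v)\<^sup>2"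
      using v by (simp add: power2_eq_square field_simps)
    also have "\<dots> \<le> 1" by simp
    finally have "1 / v + b / v\<^sup>2 \<le> 1 / (v - b)"
      using pos by (simp add: field_simps)
    moreover have "a / v\<^sup>2 \<le> b / v\<^sup>2" by (intro divide_right_mono) (auto simp: b_def)
    moreover have "(q - x) * (1 - 2 * w x) / (3 * v\<^sup>2) = a / v\<^sup>2" by (simp add: a_def)
    ultimately show ?thesis unfolding B_def x_eq v_def[symmetric] by linarith
  qed
  have Fq: "F q = 0" by (simp add: F_def bernoulli_KL_def)
  have "F q \<le> F p"
  proof (cases "p \<le> q")
    case True
    show ?thesis
    proof (rule DERIV_nonpos_imp_nonincreasing[OF True])
      fix x assume "p \<le> x" "x \<le> q"
      hence "0 < x" "x < 1" "- ((q - x) * B x) \<le> 0" using p q B[of x] by auto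
      thus "\<exists>y. (F has_real_derivative y) (at x) \<and> y \<le> 0" using deriv by blast
    qed
  next
    case False
    show ?thesis
    proof (rule DERIV_nonneg_imp_nondecreasing[where f="F" and a=q and b=p])
      fix x assume x: "q \<le> x" "x \<le> p"
      hence "0 < x" "x < 1" using p q by auto
      moreover have "(q - x) * B x \<le> 0" using x B[of x] calculation by (intro mult_nonpos_nonneg) auto
      ultimately show "\<exists>y. (F has_real_derivative y) (at x) \<and> 0 \<le> y" using deriv by fastforce
    qed (use False in auto)
  qed
  thus ?thesis using Fq by (simp add: F_def w_def)
qed

text \<open>The boundary case q = 1 of the preceding inequality, where the entropy is
  \<open>- ln p\<close>. The sign of the derivative comes down to 27x \<le> 4(2x + 1)^2.\<close>

lemma uminus_ln_ge:
  fixes p :: real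
  assumes p: "0 < p" "p \<le> 1"
  shows "9 * (1 - p) / (4 * (2 * p + 1)) \<le> - ln p"
proof -
  define F :: "real \<Rightarrow> real" where "F x = - ln x - 9 * (1 - x) / (4 * (2 * x + 1))" for x
  have "F 1 \<le> F p"
  proof (rule DERIV_nonpos_imp_nonincreasing[OF p(2)])
    fix x assume "p \<le> x" "x \<le> 1"
    hence x: "x > 0" using p by simp
    have "(F has_real_derivative - (1 / x) - ((- 9) * (4 * (2 * x + 1)) - 9 * (1 - x) * 8)
        / ((4 * (2 * x + 1)) * (4 * (2 * x + 1)))) (at x)"
      unfolding F_def using x by (auto intro!: derivative_eq_intros)
    moreover have "((- 9) * (4 * (2 * x + 1)) - 9 * (1 - x) * 8) / ((4 * (2 * x + 1)) * (4 * (2 * x + 1)))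
        = - (27 / (4 * (2 * x + 1)\<^sup>2))"
    proof -
      have "(- 9) * (4 * (2 * x + 1)) - 9 * (1 - x) * 8 = - 108" by simp
      moreover have "(4 * (2 * x + 1)) * (4 * (2 * x + 1)) = 16 * (2 * x + 1)\<^sup>2"
        by (simp add: power2_eq_square algebra_simps)
      ultimately show ?thesis by simp
    qed
    moreover have "27 / (4 * (2 * x + 1)\<^sup>2) \<le> 1 / x"
    proof -
      \<comment> \<open>Completing the square in 16x^2 - 11x + 4.\<close>
      have "0 \<le> (4 * x - 11 / 8)\<^sup>2 + (4 - (11 / 8)\<^sup>2)" by (simp add: power2_eq_square)
      also have "\<dots> = 4 * (2 * x + 1)\<^sup>2 - 27 * x" by (simp add: power2_eq_square algebra_simps)
      finally show ?thesis using x by (simp add: divide_simps)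
    qed
    ultimately show "\<exists>y. (F has_real_derivative y) (at x) \<and> y \<le> 0" by force
  qed
  thus ?thesis by (simp add: F_def)
qed

text \<open>The tilt is the one that moves the success probability from \<open>p\<close> to
  \<open>q\<close>; at \<open>k = g / q\<close> the bound would be an equality. The condition on
  \<open>k\<close> has the right direction because \<open>ln d\<close> has the sign of
  \<open>q - p\<close>.\<close>

lemma chernoff_bound_le_KL:
  fixes g k :: nat
  assumes p: "0 < p" "p < 1" and q: "0 < q" "q < 1" and k: "(q - p) * real k \<le> (q - p) * (real g / q)"
  shows "chernoff_bound k g p (q * (1 - p) / (p * (1 - q))) \<le> exp (- (real g / q) * bernoulli_KL q p)"
proof -
  define d where "d = (1 - p) / (1 - q)"
  define v where "v = q * (1 - p) / (p * (1 - q))"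
  have d: "d > 0" and v: "v > 0" using p q by (auto simp: d_def v_def)
  have D: "1 - p + p * v = d" using p q by (simp add: d_def v_def divide_simps) (simp add: algebra_simps)
  have ln_d: "ln d = - ln ((1 - q) / (1 - p))" using p q by (simp add: d_def ln_div)
  have ln_v: "ln v = ln (q / p) + ln d" using p q by (simp add: v_def d_def ln_div ln_mult)
  have "real k * ln d \<le> real g / q * ln d"
  proof (cases "p \<le> q")
    case True
    show ?thesis
    proof (cases "p = q")
      case False
      hence "q - p > 0" using True by simp
      hence "real k \<le> real g / q" using k mult_le_cancel_left_pos by blast
      moreover have "ln d \<ge> 0" using True p q by (simp add: d_def)
      ultimately show ?thesis by (intro mult_right_mono)
    qed (use q in \<open>simp add: d_def\<close>)
  next
    case False
    hence "q - p < 0" by simp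
    hence "real k \<ge> real g / q" using k mult_le_cancel_left_neg by blast
    moreover have "ln d \<le> 0" using False p q by (simp add: d_def)
    ultimately show ?thesis by (intro mult_right_mono_neg)
  qed
  hence "real k * ln d - real g * ln v \<le> - (real g / q) * bernoulli_KL q p"
    using q unfolding ln_v bernoulli_KL_def ln_d by (simp add: field_simps)
  moreover have "chernoff_bound k g p v = exp (real k * ln d - real g * ln v)"
    unfolding chernoff_bound_def D using d v by (simp add: exp_diff exp_of_nat_mult)
  ultimately show ?thesis by (simp add: v_def)
qed

section \<open>Inverse sampling\<close>

text \<open>Fewer than \<open>g\<close> successes in \<open>k\<close> trials put the waiting time
  above \<open>k\<close>, and more than \<open>g\<close> in \<open>K\<close> trials make it exist
  below \<open>K\<close>; between the two the relative error is below \<epsilon>. The two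
  complementary events are combined by a union bound.\<close>

lemma (in prob_space) inverse_sampling_prob_ge:
  fixes X :: "nat \<Rightarrow> 'a \<Rightarrow> real" and g k K :: nat
  assumes indep: "indep_vars (\<lambda>_. borel) X UNIV"
    and X01: "\<And>i \<omega>. \<omega> \<in> space M \<Longrightarrow> X i \<omega> \<in> {0, 1}"
    and Xp: "\<And>i. prob {\<omega> \<in> space M. X i \<omega> = 1} = p" and p: "0 < p" and g: "0 < g"
    and k: "\<And>n. k < n \<Longrightarrow> real g / real n < (1 + \<epsilon>) * p"
    and K: "\<And>n. 0 < n \<Longrightarrow> n < K \<Longrightarrow> (1 - \<epsilon>) * p < real g / real n"
  shows "1 - measure_pmf.prob (binomial_pmf k p) {j. -1 * real j \<le> -1 * real g}
      - measure_pmf.prob (binomial_pmf K p) {j. 1 * real j \<le> 1 * real g}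
    \<le> prob {\<omega> \<in> space M. \<exists>n::nat. (\<Sum>i<n - 1. X i \<omega>) < real g \<and>
            (\<Sum>i<n. X i \<omega>) = real g \<and> \<bar>(real g / real n - p) / p\<bar> < \<epsilon>}"
    (is "_ \<le> prob ?G")
proof -
  have [measurable]: "X i \<in> borel_measurable M" for i
    using indep by (auto simp: indep_vars_def)
  define A where "A = {\<omega> \<in> space M. (\<Sum>i<k. X i \<omega>) \<in> {real g..}}"
  define B where "B = {\<omega> \<in> space M. (\<Sum>i<K. X i \<omega>) \<in> {..real g}}"
  have AB [measurable]: "A \<in> events" "B \<in> events" unfolding A_def B_def by measurable
  have G [measurable]: "?G \<in> events" by measurable
  have sub: "space M - ?G \<subseteq> A \<union> B"
  proof (rule ccontr)
    assume "\<not> ?thesis"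
    then obtain \<omega> where \<omega>: "\<omega> \<in> space M" "\<omega> \<notin> ?G" "\<omega> \<notin> A" "\<omega> \<notin> B" by blast
    define N where "N n = card {i \<in> {..<n}. X i \<omega> = 1}" for n
    have S: "(\<Sum>i<n. X i \<omega>) = real (N n)" for n
    proof -
      have "(\<Sum>i<n. X i \<omega>) = (\<Sum>i<n. if X i \<omega> = 1 then 1 else 0)"
        using X01[OF \<omega>(1)] by (intro sum.cong) auto
      also have "\<dots> = real (N n)" by (simp add: N_def sum.If_cases Int_def)
      finally show ?thesis .
    qed
    have Nk: "N k < g" and NK: "g < N K"
      using \<omega> by (auto simp: A_def B_def S)
    have N_mono: "N a \<le> N b" if "a \<le> b" for a b
      unfolding N_def using that by (intro card_mono) auto
    have N_Suc: "N (Suc a) \<le> N a + 1" for a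
    proof -
      have "{i \<in> {..<Suc a}. X i \<omega> = 1} \<subseteq> insert a {i \<in> {..<a}. X i \<omega> = 1}" by auto
      hence "N (Suc a) \<le> card (insert a {i \<in> {..<a}. X i \<omega> = 1})"
        unfolding N_def by (intro card_mono) auto
      also have "\<dots> \<le> N a + 1" by (simp add: N_def card_insert_if)
      finally show ?thesis .
    qed
    \<comment> \<open>The first time the count reaches \<open>g\<close> it equals \<open>g\<close>,
      since the count grows by at most one per trial.\<close>
    define n where "n = (LEAST n. g \<le> N n)"
    have n: "g \<le> N n" unfolding n_def by (rule LeastI[of _ K]) (use NK in simp)
    have n0: "n > 0" using n g by (cases n) (auto simp: N_def)
    have n1: "N (n - 1) < g"
      using not_less_Least[of "n - 1" "\<lambda>n. g \<le> N n"] n0 by (simp add: n_def[symmetric])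
    have Nn: "N n = g" using n n1 N_Suc[of "n - 1"] n0 by simp
    have "k < n" using Nk n N_mono[of n k] by linarith
    moreover have "n < K" using NK Nn N_mono[of K n] by linarith
    ultimately have "\<bar>(real g / real n - p) / p\<bar> < \<epsilon>"
      using k[of n] K[of n] n0 p by (simp add: abs_less_iff field_simps)
    hence "\<omega> \<in> ?G"
      using \<omega>(1) n1 Nn by (auto simp: S intro!: exI[of _ n])
    thus False using \<omega>(2) by simp
  qed
  have "1 - prob ?G = prob (space M - ?G)" using prob_compl[OF G] by simp
  also have "\<dots> \<le> prob (A \<union> B)" using sub by (intro finite_measure_mono) auto
  also have "\<dots> \<le> prob A + prob B" by (rule measure_subadditive) auto
  also have "prob A = measure_pmf.prob (binomial_pmf k p) {j. -1 * real j \<le> -1 * real g}"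
    unfolding A_def using prob_bernoulli_sum[OF indep X01 Xp, of "{real g..}" k] by simp
  also have "prob B = measure_pmf.prob (binomial_pmf K p) {j. 1 * real j \<le> 1 * real g}"
    unfolding B_def using prob_bernoulli_sum[OF indep X01 Xp, of "{..real g}" K] by simp
  finally show ?thesis by linarith
qed

lemma poisson_rate_inverse:
  "e > 0 \<Longrightarrow> (1 + e) / ((1 + e) * ln (1 + e) - e) = 1 / poisson_rate e"
proof -
  assume "e > 0"
  hence "(1 + e) * ln (1 + e) - e = (1 + e) * poisson_rate e"
    by (simp add: poisson_rate_def field_simps)
  thus ?thesis using \<open>e > 0\<close> by simp
qed

text \<open>Any integer above the floor exceeds \<open>g / q\<close>, which gives the strict
  inequality. The second claim records the rounding loss, which accounts for the term
  \<open>- z\<close> in the denominator of \<zeta>.\<close>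

lemma floor_index:
  fixes g :: nat
  assumes "0 < q"
  defines "k \<equiv> nat \<lfloor>real g / q\<rfloor>"
  shows "real k \<le> real g / q" "real g / q - 1 < real k" "k < n \<Longrightarrow> real g / real n < q"
proof -
  have "0 \<le> real g / q" using assms by simp
  thus 1: "real k \<le> real g / q" "real g / q - 1 < real k" unfolding k_def by linarith+
  assume "k < n"
  hence "real k + 1 \<le> real n" by linarith
  hence "real g / q < real n" "0 < real n" using 1 by linarith+
  thus "real g / real n < q" using assms(1) by (simp add: field_simps)
qed

lemma ceiling_index:
  fixes g :: nat
  assumes "0 < q"
  defines "k \<equiv> nat \<lceil>real g / q\<rceil>"
  shows "real g / q \<le> real k" "0 < n \<Longrightarrow> n < k \<Longrightarrow> q < real g / real n"
proof -
  have "0 \<le> real g / q" using assms by simp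
  thus 1: "real g / q \<le> real k" unfolding k_def by linarith
  assume n: "0 < n" "n < k"
  hence "real n < real g / q" unfolding k_def by linarith
  thus "q < real g / real n" using assms(1) n by (simp add: field_simps)
qed

lemma inverse_sampling_chernoff:
  fixes g :: nat
  assumes M: "prob_space M" and indep: "prob_space.indep_vars M (\<lambda>_. borel) X UNIV"
    and X01: "\<And>i \<omega>. \<omega> \<in> space M \<Longrightarrow> X i \<omega> \<in> {0, 1 :: real}"
    and Xp: "\<And>i. measure M {\<omega> \<in> space M. X i \<omega> = 1} = p" and p: "0 < p" "p < 1"
    and \<epsilon>: "0 < \<epsilon>" and \<delta>: "0 < \<delta>" "\<delta> < 1" and g: "0 < g"
    and rate: "ln (2 / \<delta>) < real g * poisson_rate \<epsilon>"
  shows "1 - \<delta> < measure M {\<omega> \<in> space M. \<exists>n::nat. (\<Sum>i<n - 1. X i \<omega>) < real g \<and>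
            (\<Sum>i<n. X i \<omega>) = real g \<and> \<bar>(real g / real n - p) / p\<bar> < \<epsilon>}"
proof -
  interpret prob_space M by (rule M)
  have "exp (- real g * poisson_rate \<epsilon>) < exp (- ln (2 / \<delta>))" using rate by simp
  also have "\<dots> = \<delta> / 2" using \<delta> by (simp add: exp_minus)
  finally have small: "exp (- real g * poisson_rate \<epsilon>) < \<delta> / 2" .
  define k where "k = nat \<lfloor>real g / ((1 + \<epsilon>) * p)\<rfloor>"
  have q: "0 < (1 + \<epsilon>) * p" using p \<epsilon> by simp
  note k = floor_index[OF q, where g=g, folded k_def]
  have upper: "measure_pmf.prob (binomial_pmf k p) {j. -1 * real j \<le> -1 * real g} < \<delta> / 2"
  proof -
    have "measure_pmf.prob (binomial_pmf k p) {j. -1 * real j \<le> -1 * real g} \<le> chernoff_bound k g p (1 + \<epsilon>)"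
      using \<epsilon> by (intro binomial_tail_le_chernoff p) auto
    also have "\<dots> \<le> exp (- real g * poisson_rate \<epsilon>)"
      using \<epsilon> k(1) by (intro chernoff_bound_le_poisson p mult_left_mono) auto
    finally show ?thesis using small by simp
  qed
  obtain K where K: "\<And>n. 0 < n \<Longrightarrow> n < K \<Longrightarrow> (1 - \<epsilon>) * p < real g / real n"
    and lower: "measure_pmf.prob (binomial_pmf K p) {j. 1 * real j \<le> 1 * real g} < \<delta> / 2"
  proof (cases "\<epsilon> < 1")
    case True
    define K where "K = nat \<lceil>real g / ((1 - \<epsilon>) * p)\<rceil>"
    have q: "0 < (1 - \<epsilon>) * p" using p True by simp
    note K = ceiling_index[OF q, where g=g, folded K_def]
    have "measure_pmf.prob (binomial_pmf K p) {j. 1 * real j \<le> 1 * real g} \<le> chernoff_bound K g p (1 + - \<epsilon>)"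
      using \<epsilon> True by (intro binomial_tail_le_chernoff p) auto
    also have "\<dots> \<le> exp (- real g * poisson_rate (- \<epsilon>))"
      using \<epsilon> K(1) True by (intro chernoff_bound_le_poisson p mult_left_mono_neg) auto
    also have "\<dots> \<le> exp (- real g * poisson_rate \<epsilon>)"
      using poisson_rate_uminus_ge[OF \<epsilon> True] by (simp add: mult_left_mono)
    finally show ?thesis using that[of K] K small by auto
  next
    case False
    \<comment> \<open>For \<epsilon> \<ge> 1 the lower constraint on the estimate always holds, so
      \<open>K\<close> need only be so large that having at most \<open>g\<close> successes is
      unlikely; tilting by 1/2 shows this.\<close>
    have "0 < \<delta> / 2 * (1 / 2) ^ g" using \<delta> by simp
    then obtain K where K: "(1 - p + p * (1 / 2)) ^ K < \<delta> / 2 * (1 / 2) ^ g"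
      using real_arch_pow_inv[of "\<delta> / 2 * (1 / 2) ^ g" "1 - p + p * (1 / 2)"] p by auto
    have "measure_pmf.prob (binomial_pmf K p) {j. 1 * real j \<le> 1 * real g} \<le> chernoff_bound K g p (1 / 2)"
      by (intro binomial_tail_le_chernoff p) auto
    also have "\<dots> < \<delta> / 2"
      unfolding chernoff_bound_def using K by (subst pos_divide_less_eq) auto
    finally have "measure_pmf.prob (binomial_pmf K p) {j. 1 * real j \<le> 1 * real g} < \<delta> / 2" .
    moreover have "(1 - \<epsilon>) * p < real g / real n" if "0 < n" for n
    proof -
      have "(1 - \<epsilon>) * p \<le> 0" using False p by (intro mult_nonpos_nonneg) auto
      also have "0 < real g / real n" using g that by simp
      finally show ?thesis .
    qed
    ultimately show ?thesis using that[of K] by blast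
  qed
  show ?thesis
  proof (rule less_le_trans[OF _ inverse_sampling_prob_ge[OF indep]])
    show "1 - \<delta> < 1 - measure_pmf.prob (binomial_pmf k p) {j. -1 * real j \<le> -1 * real g}
        - measure_pmf.prob (binomial_pmf K p) {j. 1 * real j \<le> 1 * real g}"
      using upper lower by linarith
  qed (fact X01 Xp p(1) g k(3) K)+
qed

subsection \<open>The sharpened bound\<close>

text \<open>The setting of (II), with the condition on \<delta> replaced by its consequence
  \<open>denom_pos\<close>, derived in \<open>delta_condition\<close>.\<close>

locale sharp_bound =
  fixes p \<epsilon> \<delta> m z \<zeta> :: real and g :: nat
  assumes p: "0 < p" "p < 1" and \<epsilon>: "0 < \<epsilon>" "\<epsilon> < 1" and \<delta>: "0 < \<delta>" "\<delta> < 1" and g: "0 < g"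
    and m_def: "m = 2 / \<epsilon>\<^sup>2 * ln (1 / \<delta>)"
    and z_def: "z = 1 + 2 * \<epsilon> / (3 + \<epsilon>) - 9 / (3 + \<epsilon>)\<^sup>2 * (ln (1 / \<delta>) / ln (2 / \<delta>))"
    and \<zeta>_def: "\<zeta> = 2 * C_BE * sqrt (1 / m + z / (m - z - m * z))"
    and denom_pos: "0 < m - z - m * z"
    and rate: "ln ((1 + \<zeta>) / \<delta>) < real g * poisson_rate \<epsilon>"
begin

definition r where "r = ln (1 / \<delta>) / ln (2 / \<delta>)"

lemma ln_pos: "0 < ln (1 / \<delta>)" "0 < ln (2 / \<delta>)"
  using \<delta> by simp_all

lemma r_pos: "0 < r"
  using ln_pos by (simp add: r_def)

lemma m_pos: "0 < m"
  using ln_pos \<epsilon> by (simp add: m_def)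

lemma z_less_1: "z < 1"
proof (rule ccontr)
  assume "\<not> z < 1"
  hence "m * 1 \<le> m * z" using m_pos by (intro mult_left_mono) auto
  thus False using denom_pos \<open>\<not> z < 1\<close> by linarith
qed

text \<open>\<open>sqrt\<close> of a negative real is negative, so the sign of the radicand matters:
  it is \<open>(m - z) / (m * (m - z - m * z))\<close>, and \<open>denom_pos\<close> forces
  \<open>z < m\<close>.\<close>

lemma \<zeta>_nonneg: "0 \<le> \<zeta>"
proof -
  have "z * (1 + m) < m" using denom_pos by (simp add: algebra_simps)
  moreover have "m \<le> m * (1 + m)" using m_pos by simp
  ultimately have "z * (1 + m) < m * (1 + m)" by linarith
  hence "z < m" using m_pos by simp
  have "1 / m + z / (m - z - m * z) = (m - z) / (m * (m - z - m * z))"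
    using m_pos denom_pos by (simp add: field_simps)
  also have "\<dots> \<ge> 0" using m_pos denom_pos \<open>z < m\<close> by simp
  finally show ?thesis using C_BE_nonneg by (simp add: \<zeta>_def)
qed

lemma ln_less_rate: "ln (1 / \<delta>) < real g * poisson_rate \<epsilon>"
proof -
  have "ln (1 / \<delta>) \<le> ln ((1 + \<zeta>) / \<delta>)"
    using \<zeta>_nonneg \<delta> by (simp add: divide_right_mono)
  thus ?thesis using rate by simp
qed

lemma ln_less_square: "ln (1 / \<delta>) < real g * (\<epsilon>\<^sup>2 / 2)"
  using ln_less_rate mult_left_mono[OF poisson_rate_le[OF \<epsilon>(1)], of "real g"] by simp

lemma m_less: "m < real g"
  using ln_less_square \<epsilon> by (simp add: m_def field_simps)

text \<open>An exponent \<epsilon>^2/2 per success already pushes the bound below \<delta>;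
  enlarging it by the factor 1/r gains the missing factor 1/2, as
  \<open>ln (2 / \<delta>) = ln (1 / \<delta>) / r\<close>.\<close>

lemma exp_less_half:
  assumes "\<epsilon>\<^sup>2 / (2 * r) \<le> a"
  shows "exp (- (real g * a)) < \<delta> / 2"
proof -
  have "ln (2 / \<delta>) = ln (1 / \<delta>) / r" using ln_pos by (simp add: r_def)
  also have "\<dots> < real g * (\<epsilon>\<^sup>2 / 2) / r"
    using ln_less_square r_pos by (intro divide_strict_right_mono)
  also have "\<dots> = real g * (\<epsilon>\<^sup>2 / (2 * r))" by simp
  also have "\<dots> \<le> real g * a" using assms by (intro mult_left_mono) auto
  finally have "exp (- (real g * a)) < exp (- ln (2 / \<delta>))" by simp
  thus ?thesis using \<delta> by (simp add: exp_minus)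
qed

lemma z_eq: "z = 3 * (1 + \<epsilon>) / (3 + \<epsilon>) - 9 * r / (3 + \<epsilon>)\<^sup>2"
  using \<epsilon> by (simp add: z_def r_def field_simps)

text \<open>The Chernoff factor is below \<delta>/(1 + \<zeta>), and the tilted tail is at most (1 +
  \<zeta>)/2, because \<open>m < g\<close> and \<open>q < z\<close> bound the Berry--Esseen error by
  its value at \<open>m\<close> and \<open>z\<close>.\<close>

lemma tail_less_below_z:
  assumes c: "\<bar>c\<bar> = 1" and e_def: "e = - c * \<epsilon>" and q_def: "q = (1 + e) * p" and qz: "q < z"
    and k: "e * real k \<le> e * (real g / q)" "real g / q - 1 \<le> real k"
  shows "measure_pmf.prob (binomial_pmf k p) {j. c * real j \<le> c * real g} < \<delta> / 2"
proof -
  have c': "c = 1 \<or> c = -1" using c by linarith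
  have e: "-1 < e" "\<bar>e\<bar> = \<epsilon>" using c' \<epsilon> by (auto simp: e_def)
  have q: "0 < q" "q < 1" using p e qz z_less_1 by (auto simp: q_def)
  have "m * (1 - z) - z \<le> real g * (1 - q) - q"
    using m_less m_pos qz z_less_1 by (intro diff_mono mult_mono) auto
  hence denom: "m - z - m * z \<le> real g - q - real g * q" by (simp add: algebra_simps)
  \<comment> \<open>Rounding may lower \<open>k\<close> to \<open>g / q - 1\<close>; what remains of
    \<open>k - g\<close> is this quotient, still positive by comparison with
    \<open>denom_pos\<close>.\<close>
  have "(real g - q - real g * q) / q = real g / q - 1 - real g"
    using q by (simp add: diff_divide_distrib)
  hence kg: "(real g - q - real g * q) / q \<le> real k - real g" using k(2) by simp
  moreover have "0 < real g - q - real g * q" using denom denom_pos by linarith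
  hence pos: "0 < (real g - q - real g * q) / q" using q by (intro divide_pos_pos)
  ultimately have gk: "g < k" by linarith
  have "c * real g \<le> c * (real k * p)"
    using c'
  proof
    assume "c = 1"
    hence "e < 0" using \<epsilon> by (simp add: e_def)
    hence "real g / q \<le> real k" using k(1) by (simp only: mult_le_cancel_left_neg)
    hence "real g / q * q \<le> real k * q" using q by (intro mult_right_mono) auto
    also have "\<dots> \<le> real k * p" using \<open>c = 1\<close> \<epsilon> p by (intro mult_left_mono) (auto simp: q_def e_def)
    finally show ?thesis using q \<open>c = 1\<close> by simp
  next
    assume "c = -1"
    hence "e > 0" using \<epsilon> by (simp add: e_def)
    hence "real k \<le> real g / q" using k(1) by (simp only: mult_le_cancel_left_pos)
    hence "real k * q \<le> real g / q * q" using q by (intro mult_right_mono) auto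
    moreover have "real k * p \<le> real k * q"
      using \<open>c = -1\<close> \<epsilon> p by (intro mult_left_mono) (auto simp: q_def e_def)
    ultimately show ?thesis using q \<open>c = -1\<close> by simp
  qed
  hence "measure_pmf.prob (binomial_pmf k p) {j. c * real j \<le> c * real g}
      \<le> chernoff_bound k g p (1 + e) * (1 / 2 + C_BE * sqrt (1 / real g + 1 / (real k - real g)))"
    using e by (intro binomial_tail_le_half_chernoff p g gk c) auto
  also have "\<dots> \<le> exp (- real g * poisson_rate \<epsilon>) * (1 / 2 + \<zeta> / 2)"
  proof (intro mult_mono add_left_mono)
    have "chernoff_bound k g p (1 + e) \<le> exp (- real g * poisson_rate e)"
      using k(1) unfolding q_def by (intro chernoff_bound_le_poisson p e)
    also have "\<dots> \<le> exp (- real g * poisson_rate \<epsilon>)"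
      using c' poisson_rate_uminus_ge[OF \<epsilon>] by (auto simp: e_def mult_left_mono)
    finally show "chernoff_bound k g p (1 + e) \<le> exp (- real g * poisson_rate \<epsilon>)" .
    have "1 / (real k - real g) \<le> 1 / ((real g - q - real g * q) / q)"
      using gk by (intro divide_left_mono mult_pos_pos kg pos) auto
    also have "\<dots> = q / (real g - q - real g * q)" by simp
    also have "\<dots> \<le> z / (m - z - m * z)"
      using denom denom_pos q qz by (intro frac_le) auto
    finally have "1 / real g + 1 / (real k - real g) \<le> 1 / m + z / (m - z - m * z)"
      using m_less m_pos by (intro add_mono divide_left_mono) auto
    hence "C_BE * sqrt (1 / real g + 1 / (real k - real g)) \<le> C_BE * sqrt (1 / m + z / (m - z - m * z))"
      using C_BE_nonneg by (intro mult_left_mono) auto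
    thus "C_BE * sqrt (1 / real g + 1 / (real k - real g)) \<le> \<zeta> / 2" by (simp add: \<zeta>_def)
  qed (use \<zeta>_nonneg C_BE_nonneg gk in auto)
  also have "\<dots> < exp (- ln ((1 + \<zeta>) / \<delta>)) * (1 / 2 + \<zeta> / 2)"
    using rate \<zeta>_nonneg by (intro mult_strict_right_mono) auto
  also have "\<dots> = \<delta> / 2"
    using \<zeta>_nonneg \<delta> by (simp add: exp_minus field_simps)
  finally show ?thesis .
qed

text \<open>By \<open>bernoulli_KL_ge\<close> the exponent per success is at least
  \<open>e^2 / (2 * (1 + e) * (1 + e / 3) * (1 - w))\<close>, so it suffices that the product
  \<open>(1 + e) * (1 + e / 3) * (1 - w)\<close> be at most \<open>r\<close>. For e = \<epsilon>
  equality holds exactly at q = z, which is where \<open>z\<close> comes from.\<close>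

lemma tail_less_above_z:
  assumes c: "\<bar>c\<bar> = 1" and e_def: "e = - c * \<epsilon>" and q_def: "q = (1 + e) * p" and qz: "z \<le> q" "q < 1"
    and k: "e * real k \<le> e * (real g / q)"
  shows "measure_pmf.prob (binomial_pmf k p) {j. c * real j \<le> c * real g} < \<delta> / 2"
proof -
  have c': "c = 1 \<or> c = -1" using c by linarith
  have e: "-1 < e" "e \<le> \<epsilon>" "\<bar>e\<bar> = \<epsilon>" using c' \<epsilon> by (auto simp: e_def)
  have q: "0 < q" using p e by (simp add: q_def)
  have qp: "q - p = e * p" by (simp add: q_def algebra_simps)
  define w where "w = (2 * p + q) / 3"
  have w: "0 < w" "w < 1" using p q qz by (auto simp: w_def)
  have w_eq: "w = p * (1 + e / 3)" "w = q * ((1 + e / 3) / (1 + e))"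
    using e by (auto simp: w_def q_def field_simps)
  have "3 * (1 + \<epsilon>) - 9 * r / (3 + \<epsilon>) = z * (3 + \<epsilon>)"
    using \<epsilon> by (simp add: z_eq power2_eq_square left_diff_distrib)
  hence "3 * (1 + \<epsilon>) - 9 * r / (3 + \<epsilon>) \<le> q * (3 + \<epsilon>)"
    using mult_right_mono[OF qz(1), of "3 + \<epsilon>"] \<epsilon> by simp
  \<comment> \<open>The quotient q/w = 3(1 + e)/(3 + e) increases with \<open>e\<close>, so the case
    e = \<epsilon> is the worst.\<close>
  also have "q * (3 + \<epsilon>) \<le> 3 * w * (1 + \<epsilon>)"
  proof -
    have "(3 + \<epsilon>) * (1 + e) \<le> (3 + e) * (1 + \<epsilon>)" using e by (simp add: algebra_simps)
    hence "(3 + \<epsilon>) * q \<le> (3 + e) * (1 + \<epsilon>) * p"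
      unfolding q_def using p mult_right_mono[of "(3 + \<epsilon>) * (1 + e)" "(3 + e) * (1 + \<epsilon>)" p]
      by (simp add: mult.assoc)
    also have "(3 + e) * (1 + \<epsilon>) * p = 3 * w * (1 + \<epsilon>)" by (simp add: w_eq(1) algebra_simps)
    finally show ?thesis by (simp add: mult.commute)
  qed
  finally have "3 * (1 + \<epsilon>) * (1 - w) \<le> 9 * r / (3 + \<epsilon>)" by (simp add: algebra_simps)
  hence "3 * (1 + \<epsilon>) * (1 - w) * (3 + \<epsilon>) \<le> 9 * r" using \<epsilon> by (simp add: pos_le_divide_eq)
  moreover have "3 * (1 + \<epsilon>) * (1 - w) * (3 + \<epsilon>) = 9 * ((1 + \<epsilon>) * (1 + \<epsilon> / 3) * (1 - w))"
    by (simp add: field_simps)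
  ultimately have wr: "(1 + \<epsilon>) * (1 + \<epsilon> / 3) * (1 - w) \<le> r" by linarith
  have "(1 + e) * (1 + e / 3) * (1 - w) \<le> (1 + \<epsilon>) * (1 + \<epsilon> / 3) * (1 - w)"
    using e \<epsilon> w by (intro mult_mono mult_right_mono) auto
  hence er: "(1 + e) * (1 + e / 3) * (1 - w) \<le> r" using wr by linarith
  have epos: "0 < (1 + e) * (1 + e / 3) * (1 - w)" using e w by (intro mult_pos_pos) auto
  have "\<epsilon>\<^sup>2 / (2 * r) \<le> e\<^sup>2 / (2 * ((1 + e) * (1 + e / 3) * (1 - w)))"
    using er epos e(3) power2_abs[of e] by (intro frac_le) auto
  also have "\<dots> = (q - p)\<^sup>2 / (2 * w * (1 - w)) / q"
    unfolding qp using p e w(2)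
    by (simp add: w_eq(1) q_def power2_eq_square)
  also have "\<dots> \<le> bernoulli_KL q p / q"
    using bernoulli_KL_ge[OF p q qz(2)] q by (intro divide_right_mono) (auto simp: w_def)
  finally have exponent: "\<epsilon>\<^sup>2 / (2 * r) \<le> bernoulli_KL q p / q" .
  define v where "v = q * (1 - p) / (p * (1 - q))"
  have v: "0 < v" using p q qz by (simp add: v_def)
  have "v - 1 = (q - p) / (p * (1 - q))" using p qz by (simp add: v_def field_simps)
  hence "c * (v - 1) = c * e * (1 / (1 - q))" unfolding qp using p by simp
  also have "\<dots> \<le> 0" using c' \<epsilon> qz by (auto simp: e_def)
  finally have cv: "c * v \<le> c" by (simp add: algebra_simps)
  have "measure_pmf.prob (binomial_pmf k p) {j. c * real j \<le> c * real g} \<le> chernoff_bound k g p v"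
    by (rule binomial_tail_le_chernoff[OF p v cv c])
  also have "\<dots> \<le> exp (- (real g / q) * bernoulli_KL q p)"
  proof -
    have "(q - p) * real k \<le> (q - p) * (real g / q)"
      unfolding qp using mult_left_mono[OF k, of p] p by (simp add: mult_ac)
    thus ?thesis unfolding v_def by (intro chernoff_bound_le_KL p q qz)
  qed
  also have "- (real g / q) * bernoulli_KL q p = - (real g * (bernoulli_KL q p / q))" by simp
  also have "exp \<dots> < \<delta> / 2" by (rule exp_less_half[OF exponent])
  finally show ?thesis .
qed

text \<open>Here \<open>k \<le> g\<close>: for k < g the tail is empty, and k = g forces p = 1/(1 +
  \<epsilon>), so that the tail is \<open>p ^ g\<close>. The logarithmic inequality
  \<open>uminus_ln_ge\<close> then replaces the entropy bound.\<close>

lemma upper_tail_less_degenerate: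
  assumes q: "1 \<le> (1 + \<epsilon>) * p" and k: "real k \<le> real g / ((1 + \<epsilon>) * p)"
  shows "measure_pmf.prob (binomial_pmf k p) {j. -1 * real j \<le> -1 * real g} < \<delta> / 2"
proof (cases "k < g")
  case True
  hence "{j. -1 * real j \<le> -1 * real g} \<inter> set_pmf (binomial_pmf k p) = {}" using p by auto
  hence "measure_pmf.prob (binomial_pmf k p) {j. -1 * real j \<le> -1 * real g} = 0"
    by (metis measure_Int_set_pmf measure_empty)
  thus ?thesis using \<delta> by simp
next
  case False
  have "real g \<le> real g / ((1 + \<epsilon>) * p)" using False k by simp
  hence "real g * ((1 + \<epsilon>) * p) \<le> real g * 1" using q by (simp add: pos_le_divide_eq)
  hence q1: "(1 + \<epsilon>) * p = 1" using q g by simp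
  hence p_eq: "p = 1 / (1 + \<epsilon>)" using \<epsilon> by (simp add: field_simps)
  have kg: "k = g" using k False q1 by simp
  have "{j. -1 * real j \<le> -1 * real g} \<inter> set_pmf (binomial_pmf k p) = {g}"
    using p kg by auto
  hence "measure_pmf.prob (binomial_pmf k p) {j. -1 * real j \<le> -1 * real g} = pmf (binomial_pmf k p) g"
    by (metis measure_Int_set_pmf measure_pmf_single)
  also have "\<dots> = p ^ g" using p kg by simp
  also have "\<dots> = exp (- (real g * (- ln p)))" using p by (simp add: exp_of_nat_mult)
  also have "\<dots> < \<delta> / 2"
  proof (rule exp_less_half)
    \<comment> \<open>Cleared of denominators, \<open>z < 1\<close> yields 2 \<epsilon> (3 +
      \<epsilon>) \<le> 9 r, just what the exponent requires.\<close>
    have "z * (3 + \<epsilon>)\<^sup>2 \<le> 1 * (3 + \<epsilon>)\<^sup>2" using z_less_1 by (intro mult_right_mono) auto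
    moreover have "z * (3 + \<epsilon>)\<^sup>2 = 3 * (1 + \<epsilon>) * (3 + \<epsilon>) - 9 * r"
      using \<epsilon> by (simp add: z_eq power2_eq_square left_diff_distrib)
    ultimately have "2 * \<epsilon> * (3 + \<epsilon>) \<le> 9 * r" by (simp add: power2_eq_square algebra_simps)
    hence "\<epsilon> * (2 * \<epsilon> * (3 + \<epsilon>)) \<le> \<epsilon> * (9 * r)" using \<epsilon> by (intro mult_left_mono) auto
    hence "\<epsilon>\<^sup>2 / (2 * r) \<le> 9 * \<epsilon> / (4 * (3 + \<epsilon>))"
      using \<epsilon> r_pos by (simp add: divide_simps power2_eq_square) (simp add: algebra_simps)
    also have "\<dots> = 9 * (1 - p) / (4 * (2 * p + 1))"
      using \<epsilon> by (simp add: p_eq divide_simps)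
    also have "\<dots> \<le> - ln p" using p by (intro uminus_ln_ge) auto
    finally show "\<epsilon>\<^sup>2 / (2 * r) \<le> - ln p" .
  qed
  finally show ?thesis .
qed

lemma inverse_sampling_sharp:
  assumes M: "prob_space M" and indep: "prob_space.indep_vars M (\<lambda>_. borel) X UNIV"
    and X01: "\<And>i \<omega>. \<omega> \<in> space M \<Longrightarrow> X i \<omega> \<in> {0, 1 :: real}"
    and Xp: "\<And>i. measure M {\<omega> \<in> space M. X i \<omega> = 1} = p"
  shows "1 - \<delta> < measure M {\<omega> \<in> space M. \<exists>n::nat. (\<Sum>i<n - 1. X i \<omega>) < real g \<and>
            (\<Sum>i<n. X i \<omega>) = real g \<and> \<bar>(real g / real n - p) / p\<bar> < \<epsilon>}"
proof -
  interpret prob_space M by (rule M)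
  define k where "k = nat \<lfloor>real g / ((1 + \<epsilon>) * p)\<rfloor>"
  define K where "K = nat \<lceil>real g / ((1 - \<epsilon>) * p)\<rceil>"
  have q: "0 < (1 + \<epsilon>) * p" and q': "0 < (1 - \<epsilon>) * p" "(1 - \<epsilon>) * p < 1"
  proof -
    show "0 < (1 + \<epsilon>) * p" "0 < (1 - \<epsilon>) * p" using p \<epsilon> by simp_all
    have "(1 - \<epsilon>) * p \<le> 1 * p" using p \<epsilon> by (intro mult_right_mono) auto
    thus "(1 - \<epsilon>) * p < 1" using p by linarith
  qed
  note k = floor_index[OF q, where g=g, folded k_def]
  note K = ceiling_index[OF q'(1), where g=g, folded K_def]
  have upper: "measure_pmf.prob (binomial_pmf k p) {j. -1 * real j \<le> -1 * real g} < \<delta> / 2"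
  proof -
    consider "(1 + \<epsilon>) * p < z" | "z \<le> (1 + \<epsilon>) * p" "(1 + \<epsilon>) * p < 1" | "1 \<le> (1 + \<epsilon>) * p" by linarith
    thus ?thesis
    proof cases
      case 1
      thus ?thesis using k \<epsilon>
        by (intro tail_less_below_z[where e=\<epsilon> and q="(1 + \<epsilon>) * p"] mult_left_mono) auto
    next
      case 2
      thus ?thesis using k \<epsilon>
        by (intro tail_less_above_z[where e=\<epsilon> and q="(1 + \<epsilon>) * p"] mult_left_mono) auto
    next
      case 3
      thus ?thesis using k by (intro upper_tail_less_degenerate)
    qed
  qed
  have lower: "measure_pmf.prob (binomial_pmf K p) {j. 1 * real j \<le> 1 * real g} < \<delta> / 2"
  proof (cases "(1 - \<epsilon>) * p < z")
    case True
    thus ?thesis using K(1) \<epsilon>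
      by (intro tail_less_below_z[where e="- \<epsilon>" and q="(1 - \<epsilon>) * p"] mult_left_mono_neg) auto
  next
    case False
    thus ?thesis using K(1) \<epsilon> q'
      by (intro tail_less_above_z[where e="- \<epsilon>" and q="(1 - \<epsilon>) * p"] mult_left_mono_neg) auto
  qed
  show ?thesis
  proof (rule less_le_trans[OF _ inverse_sampling_prob_ge[OF indep]])
    show "1 - \<delta> < 1 - measure_pmf.prob (binomial_pmf k p) {j. -1 * real j \<le> -1 * real g}
        - measure_pmf.prob (binomial_pmf K p) {j. 1 * real j \<le> 1 * real g}"
      using upper lower by linarith
  qed (fact X01 Xp p(1) g k(3) K(2))+
qed

end

text \<open>With L = ln(1/\<delta>), positivity of \<open>m - z - m * z\<close> amounts to
  L^2/\<epsilon>^2 - 2bL/\<epsilon> - d > 0. The larger root is \<epsilon> (b + sqrt(b^2 + d)), and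
  the hypothesis says that L exceeds it.\<close>

lemma delta_condition:
  fixes \<epsilon> \<delta> :: real
  defines "D \<equiv> 9 - 6 * \<epsilon> - 2 * \<epsilon>\<^sup>2"
  defines "m \<equiv> 2 / \<epsilon>\<^sup>2 * ln (1 / \<delta>)"
  defines "z \<equiv> 1 + 2 * \<epsilon> / (3 + \<epsilon>) - 9 / (3 + \<epsilon>)\<^sup>2 * (ln (1 / \<delta>) / ln (2 / \<delta>))"
  assumes \<epsilon>: "0 < \<epsilon>" "\<epsilon> < 1" and \<delta>: "0 < \<delta>"
    and less: "\<delta> < exp (- (3 * \<epsilon> ^ 3 * (4 + \<epsilon>) + 4 * \<epsilon> * (3 + \<epsilon>) * ln 2) / (4 * D)
                    - \<epsilon> * sqrt (((3 * \<epsilon>\<^sup>2 * (4 + \<epsilon>) + 4 * (3 + \<epsilon>) * ln 2) / (4 * D))\<^sup>2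
                                 + 3 * (1 + \<epsilon>) * (3 + \<epsilon>) * ln 2 / (2 * D)))"
  shows "\<delta> < 1" "0 < m - z - m * z"
proof -
  define L where "L = ln (1 / \<delta>)"
  define b where "b = (3 * \<epsilon>\<^sup>2 * (4 + \<epsilon>) + 4 * (3 + \<epsilon>) * ln 2) / (4 * D)"
  define d where "d = 3 * (1 + \<epsilon>) * (3 + \<epsilon>) * ln 2 / (2 * D)"
  have l2: "ln 2 > (0 :: real)" by simp
  have "\<epsilon>\<^sup>2 < 1" using \<epsilon> by (simp add: power_less_one_iff)
  hence D: "D > 0" using \<epsilon> by (simp add: D_def)
  have b: "b > 0" unfolding b_def using \<epsilon> l2 D by (intro divide_pos_pos add_pos_pos mult_pos_pos) auto
  have d: "d > 0" unfolding d_def using \<epsilon> l2 D by (intro divide_pos_pos mult_pos_pos) auto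
  have "(3 * \<epsilon> ^ 3 * (4 + \<epsilon>) + 4 * \<epsilon> * (3 + \<epsilon>) * ln 2) / (4 * D) = \<epsilon> * b"
    by (simp add: b_def power2_eq_square power3_eq_cube algebra_simps)
  hence "\<delta> < exp (- (\<epsilon> * b) - \<epsilon> * sqrt (b\<^sup>2 + d))"
    using less unfolding b_def[symmetric] d_def[symmetric] by (simp only: minus_divide_left[symmetric])
  hence "ln \<delta> < - (\<epsilon> * b) - \<epsilon> * sqrt (b\<^sup>2 + d)"
    using \<delta> by (metis exp_less_cancel_iff exp_ln)
  moreover have "L = - ln \<delta>" using \<delta> by (simp add: L_def ln_div)
  ultimately have "\<epsilon> * (b + sqrt (b\<^sup>2 + d)) < L" by (simp add: algebra_simps)
  hence y: "b + sqrt (b\<^sup>2 + d) < L / \<epsilon>" using \<epsilon> by (simp add: pos_less_divide_eq mult.commute)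
  have "0 \<le> sqrt (b\<^sup>2 + d)" using d by simp
  hence "0 < L / \<epsilon>" using y b by linarith
  hence L: "L > 0" using \<epsilon> by (simp add: zero_less_divide_iff)
  show "\<delta> < 1" using L \<delta> by (simp add: L_def)
  have "(sqrt (b\<^sup>2 + d))\<^sup>2 < (L / \<epsilon> - b)\<^sup>2" using y d by (intro power_strict_mono) auto
  hence "b\<^sup>2 + d < (L / \<epsilon> - b)\<^sup>2" using d by simp
  hence "0 < (L / \<epsilon>)\<^sup>2 - 2 * b * (L / \<epsilon>) - d" by (simp add: power2_diff algebra_simps)
  \<comment> \<open>Multiplied by 2 D \<epsilon>^2, the quadratic becomes
    \<open>m - z - m * z\<close> times the positive factor \<epsilon>^2 (3 + \<epsilon>)^2 (L + ln
    2).\<close>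
  hence "0 < 2 * D * \<epsilon>\<^sup>2 * ((L / \<epsilon>)\<^sup>2 - 2 * b * (L / \<epsilon>) - d)" using D \<epsilon> by (intro mult_pos_pos) auto
  also have "\<dots> = 2 * D * L\<^sup>2 - \<epsilon> * L * (4 * D * b) - \<epsilon>\<^sup>2 * (2 * D * d)"
    using \<epsilon> by (simp add: power2_eq_square field_simps)
  also have "4 * D * b = 3 * \<epsilon>\<^sup>2 * (4 + \<epsilon>) + 4 * (3 + \<epsilon>) * ln 2"
    using D by (simp add: b_def)
  also have "2 * D * d = 3 * (1 + \<epsilon>) * (3 + \<epsilon>) * ln 2"
    using D by (simp add: d_def)
  also have "2 * D * L\<^sup>2 - \<epsilon> * L * (3 * \<epsilon>\<^sup>2 * (4 + \<epsilon>) + 4 * (3 + \<epsilon>) * ln 2)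
        - \<epsilon>\<^sup>2 * (3 * (1 + \<epsilon>) * (3 + \<epsilon>) * ln 2)
      = 2 * L * ((3 + \<epsilon>)\<^sup>2 * (L + ln 2))
        - (\<epsilon>\<^sup>2 + 2 * L) * ((L + ln 2) * (3 * (1 + \<epsilon>) * (3 + \<epsilon>)) - 9 * L)"
    by (simp add: D_def power2_eq_square algebra_simps)
  also have "(L + ln 2) * (3 * (1 + \<epsilon>) * (3 + \<epsilon>)) - 9 * L = z * ((3 + \<epsilon>)\<^sup>2 * (L + ln 2))"
  proof -
    have "ln (2 / \<delta>) = L + ln 2" using \<delta> by (simp add: L_def ln_div)
    hence z_eq: "z = 3 * (1 + \<epsilon>) / (3 + \<epsilon>) - 9 * L / ((3 + \<epsilon>)\<^sup>2 * (L + ln 2))"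
      using \<epsilon> by (simp add: z_def L_def[symmetric] field_simps)
    have key: "(3 * (1 + \<epsilon>) / s - 9 * L / (s\<^sup>2 * t)) * (s\<^sup>2 * t) = t * (3 * (1 + \<epsilon>) * s) - 9 * L"
      if "s \<noteq> 0" "t \<noteq> 0" for s t
      using that by (simp add: left_diff_distrib power2_eq_square)
    show ?thesis
      by (subst z_eq, rule key[symmetric]) (use L l2 \<epsilon> add_pos_pos[OF L l2] in auto)
  qed
  also have "2 * L * ((3 + \<epsilon>)\<^sup>2 * (L + ln 2)) - (\<epsilon>\<^sup>2 + 2 * L) * (z * ((3 + \<epsilon>)\<^sup>2 * (L + ln 2)))
      = (m - z - m * z) * (\<epsilon>\<^sup>2 * ((3 + \<epsilon>)\<^sup>2 * (L + ln 2)))"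
  proof -
    have "2 * L = m * \<epsilon>\<^sup>2" using \<epsilon> by (simp add: m_def L_def)
    thus ?thesis by (simp add: algebra_simps)
  qed
  finally have "0 < (m - z - m * z) * (\<epsilon>\<^sup>2 * ((3 + \<epsilon>)\<^sup>2 * (L + ln 2)))" .
  moreover have "0 < \<epsilon>\<^sup>2 * ((3 + \<epsilon>)\<^sup>2 * (L + ln 2))"
    using L l2 \<epsilon> by (intro mult_pos_pos add_pos_pos) auto
  ultimately show "0 < m - z - m * z" by (rule zero_less_mult_pos2)
qed

theorem theorem5:
  fixes M :: "'a measure" and X :: "nat \<Rightarrow> 'a \<Rightarrow> real" and p :: real
  assumes "prob_space M"
    and "\<And>i. X i \<in> borel_measurable M"
    and "prob_space.indep_vars M (\<lambda>_. borel) X UNIV"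
    and "\<And>i. \<forall>\<omega>\<in>space M. X i \<omega> \<in> {0, 1}"
    and "\<And>i. measure M {\<omega> \<in> space M. X i \<omega> = 1} = p"
    and "0 < p" and "p < 1"
  shows
   "(\<forall>(\<epsilon>::real) (\<delta>::real) (\<gamma>::nat).
       \<epsilon> > 0 \<and> 0 < \<delta> \<and> \<delta> < 1 \<and> \<gamma> > 0 \<and>
       real \<gamma> > (1 + \<epsilon>) / ((1 + \<epsilon>) * ln (1 + \<epsilon>) - \<epsilon>) * ln (2 / \<delta>) \<longrightarrow>
       measure M {\<omega> \<in> space M. \<exists>n::nat. (\<Sum>i<n - 1. X i \<omega>) < real \<gamma> \<and>
            (\<Sum>i<n. X i \<omega>) = real \<gamma> \<and> \<bar>(real \<gamma> / real n - p) / p\<bar> < \<epsilon>} > 1 - \<delta>)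
    \<and>
    (\<forall>(\<epsilon>::real) (\<delta>::real) (\<gamma>::nat).
       let D = 9 - 6 * \<epsilon> - 2 * \<epsilon>\<^sup>2;
           m = 2 / \<epsilon>\<^sup>2 * ln (1 / \<delta>);
           z = 1 + 2 * \<epsilon> / (3 + \<epsilon>) - 9 / (3 + \<epsilon>)\<^sup>2 * (ln (1 / \<delta>) / ln (2 / \<delta>));
           \<zeta> = 2 * C_BE * sqrt (1 / m + z / (m - z - m * z))
       in 0 < \<epsilon> \<and> \<epsilon> < 1 \<and> \<gamma> > 0 \<and> 0 < \<delta> \<and>
          \<delta> < exp (- (3 * \<epsilon> ^ 3 * (4 + \<epsilon>) + 4 * \<epsilon> * (3 + \<epsilon>) * ln 2) / (4 * D)
                    - \<epsilon> * sqrt (((3 * \<epsilon>\<^sup>2 * (4 + \<epsilon>) + 4 * (3 + \<epsilon>) * ln 2) / (4 * D))\<^sup>2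
                                 + 3 * (1 + \<epsilon>) * (3 + \<epsilon>) * ln 2 / (2 * D))) \<and>
          real \<gamma> > (1 + \<epsilon>) / ((1 + \<epsilon>) * ln (1 + \<epsilon>) - \<epsilon>) * ln ((1 + \<zeta>) / \<delta>) \<longrightarrow>
       measure M {\<omega> \<in> space M. \<exists>n::nat. (\<Sum>i<n - 1. X i \<omega>) < real \<gamma> \<and>
            (\<Sum>i<n. X i \<omega>) = real \<gamma> \<and> \<bar>(real \<gamma> / real n - p) / p\<bar> < \<epsilon>} > 1 - \<delta>)"
proof -
  have X01: "X i \<omega> \<in> {0, 1}" if "\<omega> \<in> space M" for i \<omega>
    using assms(4) that by blast
  \<comment> \<open>Both thresholds on the sample size are
    \<open>a / poisson_rate \<epsilon>\<close>, with different logarithms \<open>a\<close>.\<close>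
  have rate: "a < real \<gamma> * poisson_rate \<epsilon>"
    if "0 < \<epsilon>" "(1 + \<epsilon>) / ((1 + \<epsilon>) * ln (1 + \<epsilon>) - \<epsilon>) * a < real \<gamma>" for \<epsilon> a and \<gamma> :: nat
    using that poisson_rate_pos[of \<epsilon>] by (simp add: poisson_rate_inverse pos_divide_less_eq)
  show ?thesis
    unfolding Let_def
  proof (intro conjI allI impI; elim conjE)
    fix \<epsilon> \<delta> :: real and \<gamma> :: nat
    assume "0 < \<epsilon>" "0 < \<delta>" "\<delta> < 1" "0 < \<gamma>"
      "(1 + \<epsilon>) / ((1 + \<epsilon>) * ln (1 + \<epsilon>) - \<epsilon>) * ln (2 / \<delta>) < real \<gamma>"
    thus "1 - \<delta> < measure M {\<omega> \<in> space M. \<exists>n::nat. (\<Sum>i<n - 1. X i \<omega>) < real \<gamma> \<and>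
            (\<Sum>i<n. X i \<omega>) = real \<gamma> \<and> \<bar>(real \<gamma> / real n - p) / p\<bar> < \<epsilon>}"
      by (intro inverse_sampling_chernoff assms X01 rate)
  next
    fix \<epsilon> \<delta> :: real and \<gamma> :: nat
    let ?m = "2 / \<epsilon>\<^sup>2 * ln (1 / \<delta>)"
    let ?z = "1 + 2 * \<epsilon> / (3 + \<epsilon>) - 9 / (3 + \<epsilon>)\<^sup>2 * (ln (1 / \<delta>) / ln (2 / \<delta>))"
    let ?\<zeta> = "2 * C_BE * sqrt (1 / ?m + ?z / (?m - ?z - ?m * ?z))"
    assume *: "0 < \<epsilon>" "\<epsilon> < 1" "0 < \<gamma>" "0 < \<delta>"
      and \<delta>: "\<delta> < exp (- (3 * \<epsilon> ^ 3 * (4 + \<epsilon>) + 4 * \<epsilon> * (3 + \<epsilon>) * ln 2) / (4 * (9 - 6 * \<epsilon> - 2 * \<epsilon>\<^sup>2))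
          - \<epsilon> * sqrt (((3 * \<epsilon>\<^sup>2 * (4 + \<epsilon>) + 4 * (3 + \<epsilon>) * ln 2) / (4 * (9 - 6 * \<epsilon> - 2 * \<epsilon>\<^sup>2)))\<^sup>2
             + 3 * (1 + \<epsilon>) * (3 + \<epsilon>) * ln 2 / (2 * (9 - 6 * \<epsilon> - 2 * \<epsilon>\<^sup>2))))"
      and \<gamma>: "(1 + \<epsilon>) / ((1 + \<epsilon>) * ln (1 + \<epsilon>) - \<epsilon>) * ln ((1 + ?\<zeta>) / \<delta>) < real \<gamma>"
    have "sharp_bound p \<epsilon> \<delta> ?m ?z ?\<zeta> \<gamma>"
      using delta_condition[OF *(1,2,4) \<delta>] rate[OF *(1) \<gamma>] * assms(6,7) by unfold_locales auto
    thus "1 - \<delta> < measure M {\<omega> \<in> space M. \<exists>n::nat. (\<Sum>i<n - 1. X i \<omega>) < real \<gamma> \<and>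
            (\<Sum>i<n. X i \<omega>) = real \<gamma> \<and> \<bar>(real \<gamma> / real n - p) / p\<bar> < \<epsilon>}"
      by (rule sharp_bound.inverse_sampling_sharp) (use assms(1,3,5) X01 in auto)
  qed
qed

end
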